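(* Let $1\le k\le n$ be integers and let $$M=\{(x_1,\dots,x_k)\in S^{n-k}\times S^{n-k+1}\times\dots\times S^{n-1} : \langle x_i,x_j\rangle=0\ \text{ for all } i\ne j\},$$ where $S^{n-k}\subset S^{n-k+1}\subset\dots\subset S^{n-1}\subset\mathbb{R}^n$ and $x_j\in S^{n-k+j-1}$. Then every continuous $(\mathbb{Z}/2)^k$-equivariant map $$M\longrightarrow (V_{\varepsilon_1}\oplus\dots\oplus V_{\varepsilon_k})^{\oplus(n-k)}$$ has a zero.
   Context: $S^{n-1}$ is the unit sphere in $\mathbb{R}^n$, and for $d\le n-1$ the sphere $S^{d}\subset S^{n-1}$ is the equatorial sphere of unit vectors whose last $n-1-d$ coordinates vanish; $\langle x_i,x_j\rangle$ is the standard inner product on $\mathbb{R}^n$. Let $\varepsilon_1,\dots,\varepsilon_k$ be the standard generators of $(\mathbb{Z}/2)^k$. The group $(\mathbb{Z}/2)^k$ acts on $M$ by letting $\varepsilon_j$ replace $x_j$ by $-x_j$ and fix the other vectors. ($M$ is an invariant submanifold, of codimension $\binom{k}{2}$, of the Stiefel manifold $V_{n,k}$ of orthonormal $k$-tuples in $\mathbb{R}^n$.) $V_{\varepsilon_j}$ denotes the real line $\mathbb{R}$ on which $\varepsilon_j$ acts by $x\mapsto -x$ and $\varepsilon_i$, $i\ne j$, acts trivially. *)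

theory Defs
  imports "HOL-Homology.Homology" "HOL-Algebra.Group_Action"
begin

text \<open>
  Vectors of $\mathbb{R}^n$ are represented as in \<^const>\<open>Euclidean_space\<close>: functions
  \<^typ>\<open>nat \<Rightarrow> real\<close> that vanish at every index \<open>i \<ge> n\<close>. In this representation the points of
  \<^term>\<open>nsphere d\<close> are the unit vectors of $\mathbb{R}^n$ whose last $n-1-d$ coordinates vanish,
  so that the spheres are literally nested.
\<close>

definition euclidean_inner :: "nat \<Rightarrow> (nat \<Rightarrow> real) \<Rightarrow> (nat \<Rightarrow> real) \<Rightarrow> real"
  where "euclidean_inner n x y = (\<Sum>i<n. x i * y i)"

definition flag_frames :: "nat \<Rightarrow> nat \<Rightarrow> (nat \<Rightarrow> nat \<Rightarrow> real) topology"
  where "flag_frames n k =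
    subtopology (product_topology (\<lambda>j. nsphere (n - k + j - 1)) {1..k})
      {x. \<forall>i\<in>{1..k}. \<forall>j\<in>{1..k}. i \<noteq> j \<longrightarrow> euclidean_inner n (x i) (x j) = 0}"

definition Z2_power :: "nat \<Rightarrow> (nat \<Rightarrow> int) monoid"
  where "Z2_power k = product_group {1..k} (\<lambda>_. integer_mod_group 2)"

definition Z2_gen :: "nat \<Rightarrow> nat \<Rightarrow> (nat \<Rightarrow> int)"
  where "Z2_gen k j = (\<lambda>i\<in>{1..k}. if i = j then 1 else 0)"

definition frame_act :: "nat \<Rightarrow> (nat \<Rightarrow> int) \<Rightarrow> (nat \<Rightarrow> nat \<Rightarrow> real) \<Rightarrow> (nat \<Rightarrow> nat \<Rightarrow> real)"
  where "frame_act k g x = (\<lambda>j\<in>{1..k}. \<lambda>i. (-1) powi g j * x j i)"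

definition line_act :: "nat \<Rightarrow> (nat \<Rightarrow> int) \<Rightarrow> real \<Rightarrow> real"
  where "line_act j g v = (-1) powi g j * v"

text \<open>
  A point \<open>w\<close> of $(V_{\varepsilon_1}\oplus\dots\oplus V_{\varepsilon_k})^{\oplus m}$ has
  coordinate \<open>w l j\<close> in the summand $V_{\varepsilon_j}$ of the \<open>l\<close>-th copy.
\<close>

definition rep_space :: "nat \<Rightarrow> nat \<Rightarrow> (nat \<Rightarrow> nat \<Rightarrow> real) topology"
  where "rep_space k m =
    product_topology (\<lambda>_. product_topology (\<lambda>_. euclideanreal) {1..k}) {1..m}"

definition rep_act :: "nat \<Rightarrow> nat \<Rightarrow> (nat \<Rightarrow> int) \<Rightarrow> (nat \<Rightarrow> nat \<Rightarrow> real) \<Rightarrow> (nat \<Rightarrow> nat \<Rightarrow> real)"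
  where "rep_act k m g w = (\<lambda>l\<in>{1..m}. \<lambda>j\<in>{1..k}. line_act j g (w l j))"

definition rep_zero :: "nat \<Rightarrow> nat \<Rightarrow> (nat \<Rightarrow> nat \<Rightarrow> real)"
  where "rep_zero k m = (\<lambda>l\<in>{1..m}. \<lambda>j\<in>{1..k}. 0)"

definition equivariant_on ::
    "('g, 'c) monoid_scheme \<Rightarrow> 'a set \<Rightarrow> ('g \<Rightarrow> 'a \<Rightarrow> 'a) \<Rightarrow> ('g \<Rightarrow> 'b \<Rightarrow> 'b) \<Rightarrow> ('a \<Rightarrow> 'b) \<Rightarrow> bool"
  where "equivariant_on G X actX actY f \<longleftrightarrow>
    (\<forall>g\<in>carrier G. \<forall>x\<in>X. f (actX g x) = actY g (f x))"


lemma topspace_flag_frames: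
  assumes "1 \<le> k" "k \<le> n"
  shows "topspace (flag_frames n k) =
    {x \<in> extensional {1..k}.
       (\<forall>j\<in>{1..k}. (\<forall>i\<ge>n - k + j. x j i = 0) \<and> euclidean_inner n (x j) (x j) = 1) \<and>
       (\<forall>i\<in>{1..k}. \<forall>j\<in>{1..k}. i \<noteq> j \<longrightarrow> euclidean_inner n (x i) (x j) = 0)}"
proof -
  have *: "v \<in> topspace (nsphere (n - k + j - 1)) \<longleftrightarrow>
      (\<forall>i\<ge>n - k + j. v i = 0) \<and> euclidean_inner n v v = 1"
    if j: "j \<in> {1..k}" for v :: "nat \<Rightarrow> real" and j
  proof -
    have eq: "Suc (n - k + j - 1) = n - k + j" "{..n - k + j - 1} = {..<n - k + j}"
      using j by auto
    have "euclidean_inner n v v = (\<Sum>i<n - k + j. (v i)\<^sup>2)" if "\<forall>i\<ge>n - k + j. v i = 0"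
      unfolding euclidean_inner_def power2_eq_square
      by (rule sum.mono_neutral_right) (use that j assms in auto)
    then show ?thesis
      using eq by (auto simp: nsphere topspace_Euclidean_space)
  qed
  show ?thesis
    unfolding flag_frames_def using * by (auto simp: PiE_iff Pi_iff extensional_def)
qed

lemma Z2_gen_in_carrier: "Z2_gen k j \<in> carrier (Z2_power k)"
  by (auto simp: Z2_power_def Z2_gen_def carrier_integer_mod_group)

lemma frame_act_gen:
  assumes "i \<in> {1..k}"
  shows "frame_act k (Z2_gen k j) x i = (if i = j then (\<lambda>l. - x i l) else x i)"
  using assms by (auto simp: frame_act_def Z2_gen_def fun_eq_iff)

lemma line_act_gen:
  assumes "i \<in> {1..k}"
  shows "line_act i (Z2_gen k j) v = (if i = j then - v else v)"
  using assms by (auto simp: line_act_def Z2_gen_def)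

lemma carrier_Z2_power_cases:
  assumes "g \<in> carrier (Z2_power k)" "j \<in> {1..k}"
  shows "g j = 0 \<or> g j = 1"
proof -
  have "g j \<in> {0..<2}"
    using assms by (auto simp: Z2_power_def carrier_integer_mod_group PiE_iff)
  then show ?thesis by auto
qed

lemma group_Z2_power: "group (Z2_power k)"
  by (simp add: Z2_power_def)

lemma group_action_of_maps:
  assumes G: "group G"
    and cl: "\<And>g x. g \<in> carrier G \<Longrightarrow> x \<in> E \<Longrightarrow> a g x \<in> E"
    and one: "\<And>x. x \<in> E \<Longrightarrow> a \<one>\<^bsub>G\<^esub> x = x"
    and mult: "\<And>g h x. g \<in> carrier G \<Longrightarrow> h \<in> carrier G \<Longrightarrow> x \<in> E \<Longrightarrow> a (g \<otimes>\<^bsub>G\<^esub> h) x = a g (a h x)"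
  shows "group_action G E (\<lambda>g. restrict (a g) E)"
proof -
  interpret group G by fact
  have bij: "restrict (a g) E \<in> Bij E" if g: "g \<in> carrier G" for g
  proof -
    have "bij_betw (a g) E E"
      by (rule bij_betwI[where g = "a (inv\<^bsub>G\<^esub> g)"])
        (use g cl one mult[of g "inv\<^bsub>G\<^esub> g"] mult[of "inv\<^bsub>G\<^esub> g" g] in auto)
    then show ?thesis
      by (simp add: Bij_def cong: bij_betw_cong)
  qed
  have "(\<lambda>g. restrict (a g) E) \<in> hom G (BijGroup E)"
    by (rule homI) (use bij cl mult in \<open>auto simp: BijGroup_def compose_def fun_eq_iff restrict_def\<close>)
  then show ?thesis
    by (simp add: group_action_def group_hom_def group_hom_axioms_def group_BijGroup G)
qed

lemma Z2_sign_mult: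
  assumes "g \<in> carrier (Z2_power k)" "h \<in> carrier (Z2_power k)" "j \<in> {1..k}"
  shows "(-1::real) powi (g \<otimes>\<^bsub>Z2_power k\<^esub> h) j = (-1) powi g j * (-1) powi h j"
  using carrier_Z2_power_cases[OF assms(1,3)] carrier_Z2_power_cases[OF assms(2,3)] assms(3)
  by (auto simp: Z2_power_def)

lemma group_action_frames:
  assumes "1 \<le> k" "k \<le> n"
  shows "group_action (Z2_power k) (topspace (flag_frames n k))
    (\<lambda>g. restrict (frame_act k g) (topspace (flag_frames n k)))"
proof (rule group_action_of_maps[OF group_Z2_power])
  fix g x assume g: "g \<in> carrier (Z2_power k)" and x: "x \<in> topspace (flag_frames n k)"
  have "euclidean_inner n (frame_act k g x i) (frame_act k g x j) =
      (-1) powi g i * (-1) powi g j * euclidean_inner n (x i) (x j)"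
    if "i \<in> {1..k}" "j \<in> {1..k}" for i j
    using that by (simp add: euclidean_inner_def frame_act_def sum_distrib_left algebra_simps)
  moreover have "(-1::real) powi g j * (-1) powi g j = 1" if "j \<in> {1..k}" for j
    using carrier_Z2_power_cases[OF g that] by auto
  ultimately show "frame_act k g x \<in> topspace (flag_frames n k)"
    using x unfolding topspace_flag_frames[OF assms] by (auto simp: frame_act_def)
next
  fix x assume "x \<in> topspace (flag_frames n k)"
  then have "x \<in> extensional {1..k}"
    using assms by (simp add: topspace_flag_frames)
  then show "frame_act k \<one>\<^bsub>Z2_power k\<^esub> x = x"
    by (auto simp: frame_act_def Z2_power_def fun_eq_iff extensional_def)
next
  fix g h x assume "g \<in> carrier (Z2_power k)" "h \<in> carrier (Z2_power k)"
  then show "frame_act k (g \<otimes>\<^bsub>Z2_power k\<^esub> h) x = frame_act k g (frame_act k h x)"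
    using Z2_sign_mult[of g k h] by (auto simp: frame_act_def fun_eq_iff)
qed

lemma group_action_rep:
  "group_action (Z2_power k) (topspace (rep_space k m))
    (\<lambda>g. restrict (rep_act k m g) (topspace (rep_space k m)))"
proof (rule group_action_of_maps[OF group_Z2_power])
  fix g w assume "w \<in> topspace (rep_space k m)"
  then show "rep_act k m g w \<in> topspace (rep_space k m)"
    by (simp add: rep_space_def rep_act_def)
next
  fix w assume "w \<in> topspace (rep_space k m)"
  then show "rep_act k m \<one>\<^bsub>Z2_power k\<^esub> w = w"
    by (auto simp: rep_space_def rep_act_def line_act_def Z2_power_def fun_eq_iff PiE_iff extensional_def)
next
  fix g h w assume "g \<in> carrier (Z2_power k)" "h \<in> carrier (Z2_power k)"
  then show "rep_act k m (g \<otimes>\<^bsub>Z2_power k\<^esub> h) w = rep_act k m g (rep_act k m h w)"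
    using Z2_sign_mult[of g k h] by (auto simp: rep_act_def line_act_def fun_eq_iff)
qed

end

theory Submission
  imports Defs "HOL-Computational_Algebra.Polynomial" "HOL-Analysis.Urysohn"
begin

text \<open>
  Extend the components of the map equivariantly from \<open>M\<close> to the product \<open>S^d_1 \<times> \<dots> \<times> S^d_k\<close>,
  \<open>d_j = n - k + j - 1\<close>, and add the functions \<open>\<langle>x_p, x_q\<rangle>\<close>, on which \<open>\<epsilon>_p\<close> and \<open>\<epsilon>_q\<close> act by \<open>-1\<close>.
  This gives as many real functions as the product has dimensions, each transforming by a character
  of \<open>(Z/2)^k\<close>, and their common zeros are the zeros on \<open>M\<close>. The mod 2 number of orbits of zeros is
  the coefficient of \<open>h_1^d_1 \<cdots> h_k^d_k\<close> in \<open>\<Prod>_j h_j^(n-k) \<cdot> \<Prod>_(p<q) (h_p + h_q)\<close>; that coefficient is a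
  coefficient of a Vandermonde determinant and equals 1.

  The count is carried out by induction on the number \<open>r\<close> of functions. The sphere \<open>S^d\<close> is two cubes
  \<open>[-L, L]^d\<close> glued by the antipodal map of the boundary, and sums of faces on which the fixed
  coordinates alternate between \<open>L\<close> and \<open>-L\<close> play the role of the lower hemispheres. On a generic
  piecewise linear map, the zeros of the first \<open>r\<close> functions in an \<open>(r + 1)\<close>-dimensional cell are arcs;
  hence the number of zeros of the next function in the cell is congruent to the number of those
  zeros on the boundary at which that function is negative. Boundary faces cancel except for
  antipodal pairs, and such a pair contributes a full count of zeros exactly when the character of
  the next function is \<open>-1\<close>.
\<close>

section \<open>Generic piecewise linear maps\<close>

text \<open>\<open>S\<close> is the vertex set of a simplex, each \<open>f i\<close> is extended
  affinely from the vertices, and \<open>b\<close> consists of barycentric coordinates that need not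
  be normalised. Positive weights are thus points of the open simplex up to scaling.\<close>

definition null_comb :: "(nat \<Rightarrow> 'v \<Rightarrow> real) \<Rightarrow> nat \<Rightarrow> 'v set \<Rightarrow> ('v \<Rightarrow> real) \<Rightarrow> bool"
  where "null_comb f r S b \<longleftrightarrow> (\<forall>i<r. (\<Sum>v\<in>S. b v * f i v) = 0)"

definition zero_in :: "(nat \<Rightarrow> 'v \<Rightarrow> real) \<Rightarrow> nat \<Rightarrow> 'v set \<Rightarrow> bool"
  where "zero_in f r S \<longleftrightarrow> (\<exists>b. (\<forall>v\<in>S. b v > 0) \<and> null_comb f r S b)"

definition neg_in :: "(nat \<Rightarrow> 'v \<Rightarrow> real) \<Rightarrow> nat \<Rightarrow> 'v set \<Rightarrow> bool"
  where "neg_in f r S \<longleftrightarrow>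
    (\<exists>b. (\<forall>v\<in>S. b v > 0) \<and> null_comb f r S b \<and> (\<Sum>v\<in>S. b v * f r v) < 0)"

text \<open>Nonsingularity of the square matrix of values of the first \<open>card T\<close>
  functions at the vertices of \<open>T\<close>. With only the leading functions involved, passing
  from \<open>r\<close> to \<open>Suc r\<close> adds a condition only for subsets with
  \<open>Suc r\<close> vertices.\<close>

definition generic :: "(nat \<Rightarrow> 'v \<Rightarrow> real) \<Rightarrow> nat \<Rightarrow> 'v set \<Rightarrow> bool"
  where "generic f r S \<longleftrightarrow>
    (\<forall>T\<subseteq>S. card T \<le> r \<longrightarrow> (\<forall>b. null_comb f (card T) T b \<longrightarrow> (\<forall>v\<in>T. b v = 0)))"

lemma genericD:
  "generic f r S \<Longrightarrow> T \<subseteq> S \<Longrightarrow> card T \<le> r \<Longrightarrow> null_comb f (card T) T b \<Longrightarrow> v \<in> T \<Longrightarrow> b v = 0"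
  unfolding generic_def by blast

lemma null_comb_add_scaled:
  assumes "null_comb f r S b" "null_comb f r S c"
  shows "null_comb f r S (\<lambda>v. b v + t * c v)"
  using assms
  by (simp add: null_comb_def distrib_right sum.distrib mult.assoc flip: sum_distrib_left)

lemma null_comb_scaled: "null_comb f r S b \<Longrightarrow> null_comb f r S (\<lambda>v. t * b v)"
  by (simp add: null_comb_def mult.assoc flip: sum_distrib_left)

lemma null_comb_mono_neutral:
  assumes "finite S" "T \<subseteq> S" "\<And>v. v \<in> S - T \<Longrightarrow> b v = 0"
  shows "null_comb f r T b \<longleftrightarrow> null_comb f r S b"
proof -
  have "(\<Sum>v\<in>T. b v * f i v) = (\<Sum>v\<in>S. b v * f i v)" for i
    by (rule sum.mono_neutral_left) (use assms in auto)
  then show ?thesis by (simp add: null_comb_def)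
qed

lemma null_comb_cong:
  "(\<And>v. v \<in> S \<Longrightarrow> b v = c v) \<Longrightarrow> null_comb f r S b \<longleftrightarrow> null_comb f r S c"
  by (simp add: null_comb_def)

text \<open>Elimination of one equation at a time: a second solution that vanishes at a vertex
  \<open>v0\<close> in the support of the first is independent of it, and a combination of the two
  also solves the next equation.\<close>

lemma underdetermined:
  assumes "finite S" "r < card S"
  obtains c :: "'v \<Rightarrow> real" where "\<exists>v\<in>S. c v \<noteq> 0" "null_comb g r S c"
proof -
  have "\<exists>c :: 'v \<Rightarrow> real. (\<exists>v\<in>S. c v \<noteq> 0) \<and> null_comb g r S c"
    using assms
  proof (induction r arbitrary: S)
    case 0
    then obtain v where "v \<in> S" by fastforce
    then show ?case by (auto simp: null_comb_def intro!: exI[of _ "\<lambda>_. 1"])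
  next
    case (Suc r)
    obtain c1 v0 where c1: "v0 \<in> S" "c1 v0 \<noteq> 0" "null_comb g r S c1"
      using Suc.IH[of S] Suc.prems by auto
    have "\<exists>c :: 'v \<Rightarrow> real. (\<exists>v\<in>S-{v0}. c v \<noteq> 0) \<and> null_comb g r (S-{v0}) c"
      by (rule Suc.IH) (use Suc.prems c1 in auto)
    then obtain c v1 where c: "v1 \<in> S-{v0}" "c v1 \<noteq> 0" "null_comb g r (S-{v0}) c"
      by blast
    define c2 where "c2 = c(v0 := 0)"
    have c2: "null_comb g r S c2" "c2 v0 = 0" "c2 v1 \<noteq> 0"
      using c null_comb_mono_neutral[of S "S-{v0}" c2 g r]
        null_comb_cong[of "S-{v0}" c c2 g r] Suc.prems
      by (auto simp: c2_def)
    define \<alpha> \<beta> where "\<alpha> = (\<Sum>v\<in>S. c1 v * g r v)" and "\<beta> = (\<Sum>v\<in>S. c2 v * g r v)"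
    show ?case
    proof (cases "\<beta> = 0")
      case True
      then show ?thesis
        using c2 c(1) by (intro exI[of _ c2]) (auto simp: null_comb_def \<beta>_def less_Suc_eq)
    next
      case False
      let ?c = "\<lambda>v. c1 v + (- \<alpha> / \<beta>) * c2 v"
      have "(\<Sum>v\<in>S. ?c v * g r v) = \<alpha> + (- \<alpha> / \<beta>) * \<beta>"
        unfolding \<alpha>_def \<beta>_def
        by (simp add: distrib_right sum.distrib mult.assoc sum_distrib_left sum_negf sum_divide_distrib)
           (simp add: algebra_simps sum_negf sum_subtractf)
      then have "(\<Sum>v\<in>S. ?c v * g r v) = 0" using False by simp
      then have "null_comb g (Suc r) S ?c"
        using null_comb_add_scaled[OF c1(3) c2(1), of "- \<alpha> / \<beta>"]
        by (auto simp: null_comb_def less_Suc_eq)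
      moreover have "?c v0 \<noteq> 0" using c1 c2 by simp
      ultimately show ?thesis using c1(1) by (intro exI[of _ ?c]) blast
    qed
  qed
  then show thesis using that by blast
qed

text \<open>The zeros of the first \<open>r\<close> functions on a generic \<open>(r + 1)\<close>-simplex form either the empty
  set or a segment whose two end points lie in the interiors of two facets; the next function has a
  zero on that segment iff it changes sign between the end points.\<close>

lemma zero_in_iff_odd_neg_facets:
  fixes f :: "nat \<Rightarrow> 'v \<Rightarrow> real"
  assumes S: "finite S" "card S = r + 2" and gen: "generic f (Suc r) S"
  shows "zero_in f (Suc r) S \<longleftrightarrow> odd (card {u\<in>S. neg_in f r (S - {u})})"
proof -
  define K where "K b \<longleftrightarrow> null_comb f r S b" for b
  \<comment> \<open>These are the normalised zeros of the first \<open>r\<close> functions in the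
    open facet opposite to the vertex \<open>u\<close>.\<close>
  define facet where "facet u b \<longleftrightarrow>
    u \<in> S \<and> b u = 0 \<and> (\<forall>v\<in>S-{u}. b v > 0) \<and> sum b S = 1 \<and> K b" for u b
  define val where "val b = (\<Sum>v\<in>S. b v * f r v)" for b
  have val_add: "val (\<lambda>v. b v + t * c v) = val b + t * val c" for b c t
    by (simp add: val_def distrib_right sum.distrib mult.assoc flip: sum_distrib_left)
  have val_cong: "(\<And>v. v \<in> S \<Longrightarrow> b v = c v) \<Longrightarrow> val b = val c" for b c
    by (simp add: val_def)
  have Kadd: "K b \<Longrightarrow> K c \<Longrightarrow> K (\<lambda>v. b v + t * c v)" for b c t
    unfolding K_def by (rule null_comb_add_scaled)
  have sumadd: "(\<Sum>v\<in>S. b v + t * c v) = sum b S + t * sum c S" for b c :: "'v \<Rightarrow> real" and t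
    by (simp add: sum.distrib sum_distrib_left)
  have neg_facet: "neg_in f r (S-{u}) \<longleftrightarrow> (\<exists>b. facet u b \<and> val b < 0)" if u: "u \<in> S" for u
  proof
    assume "neg_in f r (S-{u})"
    then obtain b where b: "\<forall>v\<in>S-{u}. b v > 0" "null_comb f r (S-{u}) b"
      "(\<Sum>v\<in>S-{u}. b v * f r v) < 0"
      unfolding neg_in_def by blast
    define s where "s = (\<Sum>v\<in>S-{u}. b v)"
    have "S - {u} \<noteq> {}"
    proof
      assume "S - {u} = {}"
      then have "card S \<le> card {u}" by (intro card_mono) auto
      then show False using S by simp
    qed
    then have s: "s > 0" unfolding s_def using b S by (intro sum_pos) auto
    define b' where "b' = (\<lambda>v. if v = u then 0 else b v / s)"
    have "null_comb f r (S-{u}) (\<lambda>v. (1/s) * b v)" by (rule null_comb_scaled) fact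
    then have "null_comb f r (S-{u}) b'"
      by (subst null_comb_cong[where c = "\<lambda>v. (1/s) * b v"]) (auto simp: b'_def)
    then have "K b'"
      unfolding K_def by (subst null_comb_mono_neutral[symmetric, of S "S-{u}"]) (use S in \<open>auto simp: b'_def\<close>)
    moreover have "sum b' S = 1"
    proof -
      have "sum b' S = sum b' (S-{u})" by (rule sum.mono_neutral_right) (use S in \<open>auto simp: b'_def\<close>)
      also have "\<dots> = (\<Sum>v\<in>S-{u}. b v / s)" by (intro sum.cong) (auto simp: b'_def)
      also have "\<dots> = 1" using s by (simp add: s_def flip: sum_divide_distrib)
      finally show ?thesis .
    qed
    moreover have "val b' < 0"
    proof -
      have "val b' = (\<Sum>v\<in>S-{u}. b' v * f r v)"
        unfolding val_def by (rule sum.mono_neutral_right) (use S in \<open>auto simp: b'_def\<close>)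
      also have "\<dots> = (\<Sum>v\<in>S-{u}. (b v * f r v) / s)" by (intro sum.cong) (auto simp: b'_def)
      also have "\<dots> = (\<Sum>v\<in>S-{u}. b v * f r v) / s" by (simp add: sum_divide_distrib)
      finally show ?thesis using s b(3) by (simp add: divide_neg_pos)
    qed
    ultimately show "\<exists>b. facet u b \<and> val b < 0"
      using u b s by (intro exI[of _ b']) (auto simp: facet_def b'_def)
  next
    assume "\<exists>b. facet u b \<and> val b < 0"
    then obtain b where b: "facet u b" "val b < 0" by blast
    have "null_comb f r (S-{u}) b"
      by (subst null_comb_mono_neutral[of S]) (use S b in \<open>auto simp: facet_def K_def\<close>)
    moreover have "val b = (\<Sum>v\<in>S-{u}. b v * f r v)"
      unfolding val_def by (rule sum.mono_neutral_right) (use S b in \<open>auto simp: facet_def\<close>)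
    ultimately show "neg_in f r (S-{u})"
      using b unfolding neg_in_def facet_def by auto
  qed
  have val_facet: "val b \<noteq> 0" if "facet u b" for u b
  proof
    assume 0: "val b = 0"
    have "null_comb f (Suc r) S b"
      using that 0 by (auto simp: facet_def K_def val_def null_comb_def less_Suc_eq)
    moreover have card: "card (S-{u}) = Suc r" using S that by (auto simp: facet_def)
    ultimately have "null_comb f (card (S-{u})) (S-{u}) b"
      by (subst null_comb_mono_neutral[of S]) (use S that in \<open>auto simp: facet_def\<close>)
    from genericD[OF gen _ _ this] card have "\<forall>v\<in>S-{u}. b v = 0" by auto
    moreover have "S-{u} \<noteq> {}" using card by force
    ultimately obtain v where "v \<in> S-{u}" "b v = 0" by blast
    moreover from this have "b v > 0" using that unfolding facet_def by blast
    ultimately show False by simp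
  qed
  have zero_alt: "zero_in f (Suc r) S \<longleftrightarrow> (\<exists>b. (\<forall>v\<in>S. b v > 0) \<and> sum b S = 1 \<and> K b \<and> val b = 0)"
  proof
    assume "zero_in f (Suc r) S"
    then obtain b where b: "\<forall>v\<in>S. b v > 0" "null_comb f (Suc r) S b" unfolding zero_in_def by blast
    have s: "sum b S > 0" using b S by (intro sum_pos) auto
    have "null_comb f (Suc r) S (\<lambda>v. (1 / sum b S) * b v)" by (rule null_comb_scaled) fact
    then show "\<exists>b. (\<forall>v\<in>S. b v > 0) \<and> sum b S = 1 \<and> K b \<and> val b = 0"
      using b s
      by (intro exI[of _ "\<lambda>v. (1 / sum b S) * b v"])
         (auto simp: K_def val_def null_comb_def less_Suc_eq simp flip: sum_divide_distrib)
  qed (auto simp: zero_in_def K_def val_def null_comb_def less_Suc_eq)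
  \<comment> \<open>The added equation with all coefficients 1 makes the weights sum to 0, so
    \<open>c0\<close> is a direction in the affine hull of the simplex along which the first
    \<open>r\<close> functions do not change.\<close>
  obtain c0 where c0: "\<exists>v\<in>S. c0 v \<noteq> 0"
    "null_comb (\<lambda>i. if i < r then f i else (\<lambda>_. 1)) (Suc r) S c0"
    using underdetermined[of S "Suc r" "\<lambda>i. if i < r then f i else (\<lambda>_. 1)"] S by auto
  have c0K: "K c0" "sum c0 S = 0"
    using c0(2) by (auto simp: K_def null_comb_def less_Suc_eq split: if_splits)
  \<comment> \<open>Two vanishing coordinates would leave \<open>r\<close> vertices, on which
    genericity forbids a nontrivial zero.\<close>
  have one_zero: "u = w"
    if "K b" "sum b S = 1" "u \<in> S" "w \<in> S" "b u = 0" "b w = 0" for b u w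
  proof (rule ccontr)
    assume "u \<noteq> w"
    have card: "card (S-{u,w}) = r" using S that \<open>u \<noteq> w\<close> by (subst card_Diff_subset) auto
    have "null_comb f (card (S-{u,w})) (S-{u,w}) b"
      by (subst null_comb_mono_neutral[of S]) (use S that card in \<open>auto simp: K_def\<close>)
    from genericD[OF gen _ _ this] card have "\<forall>v\<in>S-{u,w}. b v = 0" by auto
    then have "sum b S = 0" using that by (intro sum.neutral) auto
    then show False using that by simp
  qed
  \<comment> \<open>Follow the direction \<open>c\<close> from the zero \<open>b\<close> until a
    coordinate first vanishes; by genericity only one does, so the exit point is interior to a
    facet. The hypothesis \<open>pos\<close> says that the ray first enters the open
    simplex.\<close>
  have move: "\<exists>t>0. \<exists>w\<in>S. facet w (\<lambda>v. b v + t * c v) \<and> c w < 0"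
    if b: "K b" "sum b S = 1" "\<forall>v\<in>S. b v \<ge> 0" and c: "K c" "sum c S = 0" "\<exists>v\<in>S. c v \<noteq> 0"
      and pos: "\<And>v. v \<in> S \<Longrightarrow> b v = 0 \<Longrightarrow> c v > 0" for b c
  proof -
    define N where "N = {v\<in>S. c v < 0}"
    have "N \<noteq> {}"
    proof
      assume "N = {}"
      then have "\<forall>v\<in>S. c v \<ge> 0" unfolding N_def by force
      then have "\<forall>v\<in>S. c v = 0" using c S by (simp add: sum_nonneg_eq_0_iff)
      then show False using c by blast
    qed
    define t where "t = Min ((\<lambda>v. b v / (- c v)) ` N)"
    have fin: "finite N" using S by (simp add: N_def)
    have "t \<in> (\<lambda>v. b v / (- c v)) ` N" unfolding t_def using fin \<open>N \<noteq> {}\<close> by (intro Min_in) auto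
    then obtain w where w: "w \<in> S" "c w < 0" "t = b w / (- c w)" unfolding N_def by blast
    have "b w > 0" using pos[of w] b w by force
    then have t: "t > 0" using w by (simp add: divide_pos_neg)
    have w0: "b w + t * c w = 0" using w by (simp add: field_simps)
    have nn: "b v + t * c v \<ge> 0" if v: "v \<in> S" for v
    proof (cases "c v < 0")
      case True
      then have "t \<le> b v / (- c v)" unfolding t_def using fin v by (intro Min_le) (auto simp: N_def)
      then show ?thesis using True by (simp add: field_simps)
    next
      case False
      then show ?thesis using b v t by auto
    qed
    have sum1: "(\<Sum>v\<in>S. b v + t * c v) = 1" using b c by (simp add: sumadd)
    have K: "K (\<lambda>v. b v + t * c v)" using b c by (intro Kadd)
    have "b v + t * c v > 0" if "v \<in> S-{w}" for v
      using one_zero[OF K sum1 _ w(1) _ w0, of v] nn[of v] that by force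
    then have "facet w (\<lambda>v. b v + t * c v)"
      using w w0 sum1 K by (auto simp: facet_def)
    then show ?thesis using t w by blast
  qed
  show ?thesis
  proof (cases "\<exists>u b. facet u b")
    case False
    have "\<not> zero_in f (Suc r) S"
    proof
      assume "zero_in f (Suc r) S"
      then obtain b where b: "\<forall>v\<in>S. b v > 0" "sum b S = 1" "K b" unfolding zero_alt by blast
      have "\<exists>t>0. \<exists>w\<in>S. facet w (\<lambda>v. b v + t * c0 v) \<and> c0 w < 0"
        by (rule move) (use b c0 c0K in \<open>auto simp: less_imp_le\<close>)
      then show False using False by blast
    qed
    moreover have "{u\<in>S. neg_in f r (S-{u})} = {}" using neg_facet False by blast
    ultimately show ?thesis by (simp only: card.empty even_zero not_True_eq_False)
  next
    case True
    then obtain u b where ub: "facet u b" by blast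
    then have u: "u \<in> S" "b u = 0" "sum b S = 1" "K b" and bpos: "\<And>v. v \<in> S \<Longrightarrow> v \<noteq> u \<Longrightarrow> b v > 0"
      by (auto simp: facet_def)
    \<comment> \<open>The normalised zeros form a line: a direction vanishing at \<open>u\<close>
      can be corrected by a multiple of \<open>b\<close> to vanish at a second vertex
      \<open>y\<close>, and is then supported on \<open>r\<close> vertices, hence trivial. The
      multiple is 0 because \<open>b\<close> has sum 1 and \<open>d\<close> has sum 0.\<close>
    have D: "\<forall>v\<in>S. d v = 0" if d: "K d" "sum d S = 0" "d u = 0" for d
    proof -
      have "card (S-{u}) = Suc r" using S u by auto
      then obtain y where y: "y \<in> S-{u}" by (metis card.empty ex_in_conv nat.distinct(1))
      have ypos: "b y > 0" using y bpos by auto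
      define l where "l = d y / b y"
      define e where "e = (\<lambda>v. d v + (-l) * b v)"
      have card: "card (S-{u,y}) = r" using S u y by (subst card_Diff_subset) auto
      have e: "K e" "e u = 0" "e y = 0"
        unfolding e_def using ypos d u Kadd[of d b "-l"] by (auto simp: l_def)
      have "null_comb f (card (S-{u,y})) (S-{u,y}) e"
        by (subst null_comb_mono_neutral[of S]) (use S e card in \<open>auto simp: K_def\<close>)
      from genericD[OF gen _ _ this] card have "\<forall>v\<in>S-{u,y}. e v = 0" by auto
      then have e0: "\<forall>v\<in>S. e v = 0" using e by auto
      then have "sum e S = 0" by (simp add: sum.neutral)
      then have "l = 0" unfolding e_def sumadd using d u by simp
      then show ?thesis using e0 by (simp add: e_def)
    qed
    have "c0 u \<noteq> 0" using D[of c0] c0 c0K by blast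
    \<comment> \<open>The sign makes \<open>c\<close> point from the facet opposite to
      \<open>u\<close> into the simplex.\<close>
    define c where "c = (\<lambda>v. sgn (c0 u) * c0 v)"
    have "sum c S = sgn (c0 u) * sum c0 S" by (simp add: c_def sum_distrib_left)
    moreover have "K c" unfolding K_def c_def by (rule null_comb_scaled) (use c0K in \<open>simp add: K_def\<close>)
    moreover have "c u > 0" using \<open>c0 u \<noteq> 0\<close> by (auto simp: c_def sgn_if)
    ultimately have c: "K c" "sum c S = 0" "c u > 0" using c0K by auto
    have "\<exists>t>0. \<exists>w\<in>S. facet w (\<lambda>v. b v + t * c v) \<and> c w < 0"
    proof (rule move)
      show "\<forall>v\<in>S. 0 \<le> b v" using bpos u by force
      show "\<exists>v\<in>S. c v \<noteq> 0" using c(3) u(1) by (intro bexI[of _ u]) auto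
      show "0 < c v" if "v \<in> S" "b v = 0" for v using that bpos[of v] c by (cases "v = u") auto
    qed (use u c in auto)
    then obtain t w where t: "t > 0" and w: "w \<in> S" "c w < 0"
      and fw: "facet w (\<lambda>v. b v + t * c v)" by blast
    have "u \<noteq> w" using w c by auto
    have w0: "b w + t * c w = 0" using fw by (auto simp: facet_def)
    \<comment> \<open>Every normalised zero lies on the line through \<open>b\<close> in direction
      \<open>c\<close>; its coordinate at \<open>u\<close>, which is 0 at \<open>b\<close>,
      determines the parameter.\<close>
    have line: "b' v = b v + (b' u / c u) * c v" if b': "K b'" "sum b' S = 1" and v: "v \<in> S" for b' v
    proof -
      let ?s = "b' u / c u"
      let ?d = "\<lambda>v. (b' v + (-1) * b v) + (- ?s) * c v"
      have "\<forall>v\<in>S. ?d v = 0"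
      proof (rule D)
        show "K ?d" using b' u c by (intro Kadd)
        show "sum ?d S = 0" unfolding sumadd using b' u c by simp
        show "?d u = 0" using u c by simp
      qed
      then show ?thesis using v by (auto simp: algebra_simps)
    qed
    have strict: "s > 0 \<and> s < t" if b': "K b'" "sum b' S = 1" "\<forall>v\<in>S. b' v > 0" and s: "s = b' u / c u" for b' s
    proof
      show "s > 0" using b' u c s by simp
      have "b' w > 0" "b' w = b w + s * c w" using line[of b' w] b' w s by auto
      then have "t * c w < s * c w" using w0 by linarith
      then show "s < t" using w by simp
    qed
    have facet_u: "val b' = val b" if "facet u b'" for b'
      using line[of b'] that by (intro val_cong) (auto simp: facet_def)
    have facet_w: "val b' = val (\<lambda>v. b v + t * c v)" if "facet w b'" for b'
    proof -
      have b': "K b'" "sum b' S = 1" "b' w = 0" using that by (auto simp: facet_def)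
      have "t * c w = (b' u / c u) * c w" using line[OF b'(1,2) w(1)] b' w0 by linarith
      then have "b' u / c u = t" using w by (metis less_irrefl mult_right_cancel)
      then show ?thesis using line[OF b'(1,2)] by (intro val_cong) auto
    qed
    \<comment> \<open>The coordinate at a third vertex \<open>x\<close> is positive at both ends of
      the segment and affine along it, so it cannot vanish in between.\<close>
    have facet_uw: "x = u \<or> x = w" if x: "facet x b'" for x b'
    proof (rule ccontr)
      assume "\<not> (x = u \<or> x = w)"
      then have xu: "x \<noteq> u" "x \<noteq> w" by auto
      have b': "K b'" "sum b' S = 1" "b' x = 0" "x \<in> S" "b' u > 0" "b' w > 0"
        using x xu u(1) w(1) by (auto simp: facet_def)
      define s where "s = b' u / c u"
      have "s > 0" using b' c by (simp add: s_def)
      have "t * c w < s * c w" using line[OF b'(1,2) w(1)] b' w0 unfolding s_def by linarith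
      then have "s < t" using w by simp
      have "b x > 0" using bpos b' xu by auto
      have "b x + t * c x > 0" using fw xu b' by (auto simp: facet_def)
      have "b x + s * c x = 0" using line[OF b'(1,2,4)] b' by (simp add: s_def)
      then have "c x < 0" using \<open>b x > 0\<close> \<open>s > 0\<close>
        by (smt (verit) mult_nonneg_nonneg)
      then have "t * c x < s * c x" using \<open>s < t\<close> by simp
      then show False using \<open>b x + s * c x = 0\<close> \<open>b x + t * c x > 0\<close> by linarith
    qed
    define \<alpha> \<beta> where "\<alpha> = val b" and "\<beta> = val (\<lambda>v. b v + t * c v)"
    have nz: "\<alpha> \<noteq> 0" "\<beta> \<noteq> 0" unfolding \<alpha>_def \<beta>_def using val_facet ub fw by blast+
    have \<beta>: "\<beta> = \<alpha> + t * val c" unfolding \<alpha>_def \<beta>_def by (rule val_add)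
    have nu: "neg_in f r (S-{u}) \<longleftrightarrow> \<alpha> < 0"
      unfolding neg_facet[OF u(1)] \<alpha>_def using facet_u ub by metis
    have nw: "neg_in f r (S-{w}) \<longleftrightarrow> \<beta> < 0"
      unfolding neg_facet[OF w(1)] \<beta>_def using facet_w fw by metis
    have set: "{x\<in>S. neg_in f r (S-{x})} = {x\<in>{u,w}. neg_in f r (S-{x})}"
      using neg_facet facet_uw u(1) w(1) by blast
    also have "\<dots> = (if \<alpha> < 0 then {u} else {}) \<union> (if \<beta> < 0 then {w} else {})"
      using nu nw by auto
    finally have odd: "odd (card {x\<in>S. neg_in f r (S-{x})}) \<longleftrightarrow> (\<alpha> < 0) \<noteq> (\<beta> < 0)"
      using \<open>u \<noteq> w\<close> by auto
    have "zero_in f (Suc r) S \<longleftrightarrow> (\<alpha> < 0) \<noteq> (\<beta> < 0)"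
    proof
      assume "zero_in f (Suc r) S"
      then obtain b' where b': "\<forall>v\<in>S. b' v > 0" "sum b' S = 1" "K b'" "val b' = 0"
        unfolding zero_alt by blast
      define s where "s = b' u / c u"
      have s: "s > 0" "s < t" using strict[OF b'(3,2,1) s_def] by auto
      have "val b' = val (\<lambda>v. b v + s * c v)"
        using line[OF b'(3,2)] by (intro val_cong) (simp add: s_def)
      then have 0: "\<alpha> + s * val c = 0" using b' by (simp add: val_add \<alpha>_def)
      then have "val c \<noteq> 0" using nz by auto
      show "(\<alpha> < 0) \<noteq> (\<beta> < 0)"
      proof (cases "val c > 0")
        case True
        then have "s * val c > 0" "s * val c < t * val c" using s by auto
        then show ?thesis using 0 \<beta> by auto
      next
        case False
        then have "s * val c < 0" "t * val c < s * val c"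
          using s \<open>val c \<noteq> 0\<close> by (auto simp: mult_pos_neg)
        then show ?thesis using 0 \<beta> by auto
      qed
    next
      assume opp: "(\<alpha> < 0) \<noteq> (\<beta> < 0)"
      \<comment> \<open>The affine function with value \<alpha> at 0 and \<beta> at \<open>t\<close>
        vanishes at this parameter.\<close>
      define s where "s = \<alpha> * t / (\<alpha> - \<beta>)"
      have st: "0 < s" "s < t"
        using opp nz t mult_nonpos_nonneg[of \<alpha> t] mult_nonpos_nonneg[of \<beta> t]
        by (auto simp: s_def field_simps zero_less_mult_iff not_less less_le)
      have "\<alpha> - \<beta> \<noteq> 0" using opp by auto
      have "val (\<lambda>v. b v + s * c v) = \<alpha> + s * val c" by (simp add: val_add \<alpha>_def)
      also have "val c = (\<beta> - \<alpha>) / t" using \<beta> t by (simp add: field_simps)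
      also have "\<alpha> + s * ((\<beta> - \<alpha>) / t) = 0"
        using t \<open>\<alpha> - \<beta> \<noteq> 0\<close> unfolding s_def by (simp add: field_simps)
      finally have "val (\<lambda>v. b v + s * c v) = 0" .
      moreover have "b v + s * c v > 0" if v: "v \<in> S" for v
      proof -
        have 1: "b v \<ge> 0" "b v + t * c v \<ge> 0" "b v > 0 \<or> b v + t * c v > 0"
        proof -
          have *: "v \<noteq> w \<Longrightarrow> b v + t * c v > 0" using fw v unfolding facet_def by blast
          show "b v \<ge> 0" using bpos[OF v] u by (cases "v = u") auto
          show "b v + t * c v \<ge> 0" using * w0 by (cases "v = w") auto
          show "b v > 0 \<or> b v + t * c v > 0" using bpos[OF v] * \<open>u \<noteq> w\<close> by (cases "v = u") auto
        qed
        have "b v + s * c v = ((t - s) * b v + s * (b v + t * c v)) / t" using t by (simp add: field_simps)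
        moreover have "(t - s) * b v + s * (b v + t * c v) > 0"
          using 1 st
          by (metis add_nonneg_pos add_pos_nonneg diff_gt_0_iff_gt less_imp_le mult_nonneg_nonneg mult_pos_pos)
        ultimately show ?thesis using t by simp
      qed
      moreover have "K (\<lambda>v. b v + s * c v)" by (intro Kadd u c)
      moreover have "(\<Sum>v\<in>S. b v + s * c v) = 1" using u c by (simp add: sumadd)
      ultimately show "zero_in f (Suc r) S"
        unfolding zero_alt by (intro exI[of _ "\<lambda>v. b v + s * c v"]) simp
    qed
    then show ?thesis using odd by simp
  qed
qed

section \<open>Signs at the zeros in a generic simplex\<close>

definition pos_in :: "(nat \<Rightarrow> 'v \<Rightarrow> real) \<Rightarrow> nat \<Rightarrow> 'v set \<Rightarrow> bool"
  where "pos_in f r S \<longleftrightarrow>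
    (\<exists>b. (\<forall>v\<in>S. b v > 0) \<and> null_comb f r S b \<and> (\<Sum>v\<in>S. b v * f r v) > 0)"

lemma generic_no_zero:
  assumes "card S = Suc r" "generic f (Suc r) S" "\<forall>v\<in>S. b v > 0" "null_comb f r S b"
  shows "(\<Sum>v\<in>S. b v * f r v) \<noteq> 0"
proof
  assume "(\<Sum>v\<in>S. b v * f r v) = 0"
  then have "null_comb f (card S) S b" using assms by (auto simp: null_comb_def less_Suc_eq)
  then have "\<forall>v\<in>S. b v = 0" using genericD[OF assms(2), of S b] assms(1) by auto
  moreover obtain v where "v \<in> S" using assms(1) by (metis card.empty ex_in_conv nat.distinct(1))
  ultimately show False using assms(3) by fastforce
qed

lemma zero_in_iff_neg_or_pos:
  assumes "card S = Suc r" "generic f (Suc r) S"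
  shows "zero_in f r S \<longleftrightarrow> neg_in f r S \<or> pos_in f r S"
  using generic_no_zero[OF assms] unfolding zero_in_def neg_in_def pos_in_def by (meson linorder_neqE)

text \<open>A suitable positive combination of a zero with negative value and one with positive
  value would be a zero of the next function as well, contrary to genericity.\<close>

lemma not_neg_and_pos:
  assumes S: "card S = Suc r" "generic f (Suc r) S" and "neg_in f r S" "pos_in f r S"
  shows False
proof -
  obtain b where b: "\<forall>v\<in>S. b v > 0" "null_comb f r S b" "(\<Sum>v\<in>S. b v * f r v) < 0"
    using assms unfolding neg_in_def by blast
  obtain c where c: "\<forall>v\<in>S. c v > 0" "null_comb f r S c" "(\<Sum>v\<in>S. c v * f r v) > 0"
    using assms unfolding pos_in_def by blast
  define t where "t = - (\<Sum>v\<in>S. b v * f r v) / (\<Sum>v\<in>S. c v * f r v)"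
  have "t > 0" using b c by (simp add: t_def divide_neg_pos)
  then have "\<forall>v\<in>S. b v + t * c v > 0" using b c by (simp add: add_pos_pos)
  then have "(\<Sum>v\<in>S. (b v + t * c v) * f r v) \<noteq> 0"
    by (rule generic_no_zero[OF S]) (rule null_comb_add_scaled[OF b(2) c(2)])
  moreover have "(\<Sum>v\<in>S. (b v + t * c v) * f r v) = (\<Sum>v\<in>S. b v * f r v) + t * (\<Sum>v\<in>S. c v * f r v)"
    by (simp add: distrib_right sum.distrib mult.assoc flip: sum_distrib_left)
  ultimately show False using c by (simp add: t_def)
qed

section \<open>Perturbation to generic position\<close>

lemma finite_perturbed_roots:
  fixes c F sg :: "'v \<Rightarrow> real"
  assumes T: "finite T" "inj_on idx T" "v0 \<in> T" and pos: "\<And>v. v \<in> T \<Longrightarrow> idx v > 0"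
    and nz: "c v0 * sg v0 \<noteq> 0"
  shows "finite {t. (\<Sum>v\<in>T. c v * (F v + sg v * t ^ idx v)) = 0}"
proof -
  \<comment> \<open>Since \<open>idx\<close> is injective and positive, the term of
    \<open>v0\<close> is alone in its degree and away from the constant term, so this polynomial in
    \<open>t\<close> is nonzero.\<close>
  define p where "p = pCons (\<Sum>v\<in>T. c v * F v) 0 + (\<Sum>v\<in>T. Polynomial.monom (c v * sg v) (idx v))"
  have "poly p t = (\<Sum>v\<in>T. c v * (F v + sg v * t ^ idx v))" for t
    by (simp add: p_def poly_sum poly_monom distrib_left sum.distrib mult.assoc)
  moreover have "Polynomial.coeff p (idx v0) = (\<Sum>v\<in>T. if v = v0 then c v * sg v else 0)"
  proof -
    have "Polynomial.coeff p (idx v0) = (\<Sum>v\<in>T. if idx v = idx v0 then c v * sg v else 0)"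
      using pos[OF T(3)] by (simp add: p_def coeff_sum coeff_pCons split: nat.split)
    also have "\<dots> = (\<Sum>v\<in>T. if v = v0 then c v * sg v else 0)"
      by (intro sum.cong) (use T in \<open>auto dest: inj_onD\<close>)
    finally show ?thesis .
  qed
  then have "p \<noteq> 0" using T nz by auto
  ultimately show ?thesis using poly_roots_finite[of p] by simp
qed

text \<open>The relations among the first \<open>r\<close> functions on \<open>r + 1\<close>
  vertices form a line spanned by some \<open>c\<close> without zero entries. Genericity fails only
  if the new function satisfies the relation \<open>c\<close> too, which is a nontrivial polynomial
  equation for \<open>t\<close>.\<close>

lemma generic_Suc_perturbation:
  fixes f :: "nat \<Rightarrow> 'v \<Rightarrow> real"
  assumes T: "finite T" "inj_on idx T" "card T = Suc r" and pos: "\<And>v. v \<in> T \<Longrightarrow> idx v > 0"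
    and sg: "\<And>v. v \<in> T \<Longrightarrow> sg v \<noteq> 0"
    and gen: "generic f r T"
  shows "finite {t. \<not> generic (f(r := \<lambda>v. F v + sg v * t ^ idx v)) (Suc r) T}" (is "finite ?B")
proof -
  obtain c where c: "\<exists>v\<in>T. c v \<noteq> 0" "null_comb f r T c"
    using underdetermined[of T r f] T by auto
  have zero: "\<forall>v\<in>T. b v = 0" if b: "null_comb f r T b" "b y = 0" "y \<in> T" for b y
  proof -
    have card: "card (T - {y}) = r" using T b by simp
    have "null_comb f (card (T-{y})) (T-{y}) b"
      unfolding card by (subst null_comb_mono_neutral[of T]) (use T b in auto)
    from genericD[OF gen _ _ this] card b(2) show ?thesis by auto
  qed
  have cnz: "c v \<noteq> 0" if "v \<in> T" for v using zero[OF c(2) _ that] c(1) by blast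
  obtain v0 where v0: "v0 \<in> T" using c(1) by blast
  define Z where "Z = {t. (\<Sum>v\<in>T. c v * (F v + sg v * t ^ idx v)) = 0}"
  have "finite Z" unfolding Z_def
    by (rule finite_perturbed_roots[of _ _ v0]) (use T v0 pos cnz sg in auto)
  moreover have "?B \<subseteq> Z"
  proof (rule subsetI, rule ccontr)
    fix t assume "t \<in> ?B" "t \<notin> Z"
    let ?f = "f(r := \<lambda>v. F v + sg v * t ^ idx v)"
    have "generic ?f (Suc r) T" unfolding generic_def
    proof (intro allI impI ballI)
      fix U b v assume U: "U \<subseteq> T" "card U \<le> Suc r" and b: "null_comb ?f (card U) U b" and v: "v \<in> U"
      show "b v = 0"
      proof (cases "card U \<le> r")
        case True
        then have "null_comb f (card U) U b" using b by (auto simp: null_comb_def)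
        then show ?thesis using genericD[OF gen U(1) True] v by blast
      next
        case False
        then have "U = T" using U T by (intro card_subset_eq) auto
        define l where "l = b v / c v"
        have b': "null_comb f r T b" "(\<Sum>v\<in>T. b v * (F v + sg v * t ^ idx v)) = 0"
          using b T \<open>U = T\<close> by (auto simp: null_comb_def less_Suc_eq)
        have "\<forall>w\<in>T. b w + (- l) * c w = 0"
          by (rule zero[of _ v])
             (use null_comb_add_scaled[OF b'(1) c(2), of "-l"] cnz v \<open>U = T\<close> in \<open>auto simp: l_def\<close>)
        then have bl: "b w = l * c w" if "w \<in> T" for w using that by auto
        have "l * (\<Sum>v\<in>T. c v * (F v + sg v * t ^ idx v)) = 0"
          using b'(2) bl by (simp add: sum_distrib_left mult.assoc cong: sum.cong)
        then have "l = 0" using \<open>t \<notin> Z\<close> by (simp add: Z_def)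
        then show ?thesis using bl v U by auto
      qed
    qed
    then show False using \<open>t \<in> ?B\<close> by simp
  qed
  ultimately show ?thesis by (rule rev_finite_subset)
qed

text \<open>The parameters are chosen one function at a time, each avoiding finitely many bad values
  for the simplices with \<open>Suc R\<close> vertices; smaller simplices involve only functions
  already chosen. Closure under subsets puts every face to be tested into the family.\<close>

lemma generic_perturbation:
  fixes F sg :: "nat \<Rightarrow> 'v \<Rightarrow> real" and idx :: "'v \<Rightarrow> nat"
  assumes fin: "finite \<T>" "\<And>T. T \<in> \<T> \<Longrightarrow> finite T"
    and sub: "\<And>T U. T \<in> \<T> \<Longrightarrow> U \<subseteq> T \<Longrightarrow> U \<in> \<T>"
    and inj: "\<And>T. T \<in> \<T> \<Longrightarrow> inj_on idx T"
    and pos: "\<And>T v. T \<in> \<T> \<Longrightarrow> v \<in> T \<Longrightarrow> idx v > 0"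
    and sg: "\<And>T v r. T \<in> \<T> \<Longrightarrow> v \<in> T \<Longrightarrow> sg r v \<noteq> 0"
    and "\<epsilon> > (0::real)"
  shows "\<exists>t. (\<forall>r<R. 0 < t r \<and> t r < \<epsilon>) \<and>
    (\<forall>T\<in>\<T>. generic (\<lambda>r v. F r v + sg r v * t r ^ idx v) R T)"
proof (induction R)
  case 0
  have "generic f 0 T" if "finite T" for T and f :: "nat \<Rightarrow> 'v \<Rightarrow> real"
    unfolding generic_def using that by (auto dest: finite_subset)
  then show ?case using fin by simp
next
  case (Suc R)
  then obtain t where t: "\<forall>r<R. 0 < t r \<and> t r < \<epsilon>"
    "\<forall>T\<in>\<T>. generic (\<lambda>r v. F r v + sg r v * t r ^ idx v) R T" by blast
  define f where "f = (\<lambda>r v. F r v + sg r v * t r ^ idx v)"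
  define B where "B T = {t. \<not> generic (f(R := \<lambda>v. F R v + sg R v * t ^ idx v)) (Suc R) T}" for T
  have "finite (\<Union> (B ` {T\<in>\<T>. card T = Suc R}))"
  proof (intro finite_UN_I)
    fix T assume "T \<in> {T\<in>\<T>. card T = Suc R}"
    then show "finite (B T)" unfolding B_def
      by (intro generic_Suc_perturbation) (use fin inj pos sg t in \<open>auto simp: f_def\<close>)
  qed (use fin in auto)
  moreover have "infinite {0<..<\<epsilon>}" using \<open>\<epsilon> > 0\<close> by (rule infinite_Ioo)
  ultimately have "\<not> {0<..<\<epsilon>} \<subseteq> \<Union> (B ` {T\<in>\<T>. card T = Suc R})"
    using finite_subset by blast
  then obtain s where s: "0 < s" "s < \<epsilon>" "\<And>T. T \<in> \<T> \<Longrightarrow> card T = Suc R \<Longrightarrow> s \<notin> B T"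
    by (auto simp: subset_iff)
  define t' where "t' = t(R := s)"
  let ?f = "\<lambda>r v. F r v + sg r v * t' r ^ idx v"
  have f': "?f = f(R := \<lambda>v. F R v + sg R v * s ^ idx v)"
    by (auto simp: f_def t'_def fun_eq_iff)
  have "generic ?f (Suc R) T" if T: "T \<in> \<T>" for T
    unfolding generic_def
  proof (intro allI impI)
    fix U b assume U: "U \<subseteq> T" "card U \<le> Suc R" and b: "null_comb ?f (card U) U b"
    have "U \<in> \<T>" using sub T U by blast
    show "\<forall>v\<in>U. b v = 0"
    proof (cases "card U = Suc R")
      case True
      then have "generic ?f (Suc R) U" using s(3)[of U] \<open>U \<in> \<T>\<close> unfolding B_def f' by blast
      then show ?thesis using genericD[of ?f "Suc R" U U b] b U by blast
    next
      case False
      then have "card U \<le> R" using U by simp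
      moreover have "null_comb f (card U) U b"
        using b calculation by (auto simp: f' null_comb_def)
      ultimately show ?thesis using genericD[of f R U U b] t(2) \<open>U \<in> \<T>\<close> unfolding f_def by blast
    qed
  qed
  then show ?case using t s by (intro exI[of _ t']) (auto simp: t'_def less_Suc_eq)
qed

section \<open>The barycentric subdivision of a cubical grid\<close>

text \<open>A grid point \<open>x\<close> stands for the barycentre of the cubical cell whose directions are the
  odd coordinates of \<open>x\<close>, and \<open>fle\<close> is the face relation. Chains are thus the simplices of the
  barycentric subdivision of the grid, a triangulation preserved by every change of signs.\<close>

definition fle :: "('c \<Rightarrow> int) \<Rightarrow> ('c \<Rightarrow> int) \<Rightarrow> bool"
  where "fle x y \<longleftrightarrow> (\<forall>c. x c = y c \<or> odd (y c) \<and> \<bar>x c - y c\<bar> = 1)"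

definition face :: "int \<Rightarrow> 'c set \<Rightarrow> ('c \<Rightarrow> int) \<Rightarrow> ('c \<Rightarrow> int) set"
  where "face L A w = {x. \<forall>c. if c \<in> A then \<bar>x c\<bar> \<le> L else x c = w c}"

text \<open>\<open>r\<close> counts vertices, so these are the \<open>(r - 1)\<close>-simplices of
  the subdivided face.\<close>

definition flags :: "int \<Rightarrow> 'c set \<Rightarrow> ('c \<Rightarrow> int) \<Rightarrow> nat \<Rightarrow> ('c \<Rightarrow> int) set set"
  where "flags L A w r =
    {T. T \<subseteq> face L A w \<and> card T = r \<and> (\<forall>x\<in>T. \<forall>y\<in>T. fle x y \<or> fle y x)}"

definition odds :: "'c set \<Rightarrow> ('c \<Rightarrow> int) \<Rightarrow> 'c set"
  where "odds A x = {c\<in>A. odd (x c)}"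

lemma fle_refl: "fle x x" by (simp add: fle_def)

lemma fle_even: "fle x y \<Longrightarrow> even (y c) \<Longrightarrow> x c = y c"
  unfolding fle_def by metis

lemma fle_odd: "fle x y \<Longrightarrow> odd (x c) \<Longrightarrow> x c = y c"
  unfolding fle_def by (smt (verit) dvd_diff_right_iff even_add odd_one abs_if even_diff minus_diff_eq even_minus)

lemma fle_trans:
  assumes "fle x y" "fle y z"
  shows "fle x z"
  unfolding fle_def
proof
  fix c
  show "x c = z c \<or> odd (z c) \<and> \<bar>x c - z c\<bar> = 1"
    using assms fle_odd[OF assms(2), of c] fle_even[OF assms(1), of c] unfolding fle_def by metis
qed

lemma face_bound: "x \<in> face L A w \<Longrightarrow> c \<in> A \<Longrightarrow> \<bar>x c\<bar> \<le> L"
  unfolding face_def by simp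

lemma face_fixed: "x \<in> face L A w \<Longrightarrow> c \<notin> A \<Longrightarrow> x c = w c"
  unfolding face_def by simp

lemma finite_face: "finite A \<Longrightarrow> finite (face L A w)"
proof -
  assume "finite A"
  then have "finite ((\<lambda>g c. if c \<in> A then g c else w c) ` (PiE A (\<lambda>_. {-L..L})))"
    by (intro finite_imageI finite_PiE) auto
  moreover have "face L A w \<subseteq> (\<lambda>g c. if c \<in> A then g c else w c) ` (PiE A (\<lambda>_. {-L..L}))"
  proof
    fix x assume "x \<in> face L A w"
    then have "- L \<le> x c \<and> x c \<le> L" if "c \<in> A" for c
      using face_bound[of x L A w c] that by auto
    moreover have "x = (\<lambda>c. if c \<in> A then restrict x A c else w c)"
      using \<open>x \<in> face L A w\<close> by (auto simp: face_def fun_eq_iff)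
    ultimately show "x \<in> (\<lambda>g c. if c \<in> A then g c else w c) ` (PiE A (\<lambda>_. {-L..L}))"
      by (intro image_eqI[of _ _ "restrict x A"]) (simp_all add: PiE_iff)
  qed
  ultimately show ?thesis by (rule rev_finite_subset)
qed

lemma finite_flags: "finite A \<Longrightarrow> finite (flags L A w r)"
  by (rule finite_subset[of _ "Pow (face L A w)"]) (auto simp: flags_def finite_face)

lemma flags_finite: "finite A \<Longrightarrow> T \<in> flags L A w r \<Longrightarrow> finite T"
  by (auto simp: flags_def intro: finite_subset finite_face)

section \<open>Dimensions of the cells in a chain\<close>

lemma fle_odds_subset: "fle x y \<Longrightarrow> odds A x \<subseteq> odds A y"
  using fle_odd[of x y] by (auto simp: odds_def)

lemma fle_odds_eq:
  assumes "fle x y" "odds A x = odds A y" "x \<in> face L A w" "y \<in> face L A w"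
  shows "x = y"
proof
  fix c show "x c = y c"
    using assms fle_even[OF assms(1), of c] fle_odd[OF assms(1), of c]
    by (cases "c \<in> A") (auto simp: odds_def face_def)
qed

lemma fle_card_odds_less:
  assumes "finite A" "fle x y" "x \<noteq> y" "x \<in> face L A w" "y \<in> face L A w"
  shows "card (odds A x) < card (odds A y)"
  using assms fle_odds_subset[OF assms(2), of A] fle_odds_eq[OF assms(2), of A]
  by (intro psubset_card_mono) (auto simp: odds_def)

lemma inj_on_card_odds:
  assumes "finite A" "T \<subseteq> face L A w" "\<forall>x\<in>T. \<forall>y\<in>T. fle x y \<or> fle y x"
  shows "inj_on (\<lambda>x. card (odds A x)) T"
proof (rule inj_onI, rule ccontr)
  fix x y assume "x \<in> T" "y \<in> T" "card (odds A x) = card (odds A y)" "x \<noteq> y"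
  then show False using assms fle_card_odds_less[of A x y] fle_card_odds_less[of A y x] by (metis less_irrefl subsetD)
qed

lemma card_odds_le: "finite A \<Longrightarrow> card (odds A x) \<le> card A"
  by (intro card_mono) (auto simp: odds_def)

lemma comparable_fle_of_card_less:
  assumes "finite A" "fle x y \<or> fle y x" "x \<in> face L A w" "y \<in> face L A w"
    "card (odds A x) \<le> card (odds A y)"
  shows "fle x y"
  using assms fle_card_odds_less[of A y x] by (metis fle_refl leD)

lemma insert_flagI:
  assumes "T \<in> flags L A w r" "finite A" "z \<in> face L A w" "z \<notin> T"
    "\<And>t. t \<in> T \<Longrightarrow> fle z t \<or> fle t z"
  shows "insert z T \<in> flags L A w (Suc r)"
  using assms flags_finite[OF assms(2,1)] by (auto simp: flags_def fle_refl)

text \<open>Cells in a chain have distinct dimensions, so \<open>card A\<close> of the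
  \<open>card A + 1\<close> possible dimensions occur.\<close>

lemma flags_missing_rank:
  assumes "finite A" "T \<in> flags L A w (card A)"
  obtains i where "i \<le> card A" "(\<lambda>x. card (odds A x)) ` T = {..card A} - {i}"
proof -
  let ?R = "(\<lambda>x. card (odds A x)) ` T"
  have "inj_on (\<lambda>x. card (odds A x)) T"
    using assms inj_on_card_odds[of A T L w] by (auto simp: flags_def)
  then have card: "card ?R = card A" using assms by (simp add: card_image flags_def)
  have sub: "?R \<subseteq> {..card A}" using assms(1) by (auto simp: card_odds_le)
  then have "card ({..card A} - ?R) = 1" using card by (subst card_Diff_subset) (auto intro: finite_subset)
  then obtain i where i: "{..card A} - ?R = {i}" by (rule card_1_singletonE)
  show thesis
  proof (rule that)
    show "i \<le> card A" using i by auto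
    show "?R = {..card A} - {i}" using i sub by (auto simp: subset_iff)
  qed
qed

lemma fle_insert_odds:
  assumes "fle x z" "odds A z = insert a (odds A x)" "x \<in> face L A w" "z \<in> face L A w"
  shows "z = x(a := z a)"
proof
  fix c
  have "z c = x c" if "c \<noteq> a"
  proof (cases "c \<in> A")
    case True
    show ?thesis
    proof (cases "odd (z c)")
      case True
      then have "c \<in> odds A x" using assms(2) \<open>c \<in> A\<close> that by (auto simp: odds_def)
      then show ?thesis using fle_odd[OF assms(1), of c] by (simp add: odds_def)
    qed (simp add: fle_even[OF assms(1)])
  next
    case False
    then show ?thesis using assms face_fixed by metis
  qed
  then show "z c = (x(a := z a)) c" by simp
qed

text \<open>The triangulated cube is a pseudomanifold with boundary: a simplex of codimension 1 lies
  in two maximal simplices, or in one maximal simplex and one boundary facet. The cases follow the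
  dimension \<open>i\<close> missing from the chain \<open>T\<close>.\<close>

lemma even_completions_add_facets:
  assumes A: "finite A" "A \<noteq> {}" and L: "even L" "L > 0" and T: "T \<in> flags L A w (card A)"
  shows "even (card {z \<in> face L A w - T. insert z T \<in> flags L A w (Suc (card A))} +
    card {(a, s) \<in> A \<times> {L, -L}. T \<in> flags L (A - {a}) (w(a := s)) (card A)})"
    (is "even (card ?Z + card ?B)")
proof -
  let ?r = "\<lambda>x. card (odds A x)"
  obtain i where i: "i \<le> card A" "?r ` T = {..card A} - {i}"
    using flags_missing_rank[OF A(1) T] by blast
  have Tf: "T \<subseteq> face L A w" and Tc: "\<And>x y. x \<in> T \<Longrightarrow> y \<in> T \<Longrightarrow> fle x y \<or> fle y x"
    using T by (auto simp: flags_def)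
  have ri: "?r t \<noteq> i" if "t \<in> T" for t using i that by blast
  have finodds: "finite (odds A x)" for x using A by (simp add: odds_def)
  have cmp: "fle x y" if "x \<in> T" "y \<in> T" "?r x \<le> ?r y" for x y
    by (rule comparable_fle_of_card_less[OF A(1)]) (use Tf Tc that in auto)
  have Zi: "?r z = i" if "z \<in> ?Z" for z
  proof -
    have "inj_on ?r (insert z T)" using A(1) that inj_on_card_odds[of A "insert z T" L w] by (auto simp: flags_def)
    then have "?r z \<notin> ?r ` T" using that by auto
    then show ?thesis using i card_odds_le[OF A(1), of z] by auto
  qed
  have Zcmp: "(?r z \<le> ?r t \<longrightarrow> fle z t) \<and> (?r t \<le> ?r z \<longrightarrow> fle t z)" if "z \<in> ?Z" "t \<in> T" for z t
  proof -
    have "fle z t \<or> fle t z" "z \<in> face L A w" "t \<in> face L A w" using that Tf by (auto simp: flags_def)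
    then show ?thesis
      using comparable_fle_of_card_less[OF A(1), of z t L w] comparable_fle_of_card_less[OF A(1), of t z L w]
      by blast
  qed
  have ZI: "z \<in> ?Z" if "z \<in> face L A w" "?r z = i" "\<And>t. t \<in> T \<Longrightarrow> fle z t \<or> fle t z" for z
    using that insert_flagI[OF T A(1), of z] ri[of z] by blast
  have ex: "\<exists>x\<in>T. ?r x = l" if "l \<le> card A" "l \<noteq> i" for l
    using i that by (metis (no_types, lifting) DiffI atMost_iff imageE singletonD)
  have fZ: "z \<in> face L A w" if "z \<in> ?Z" for z using that by simp
  have cardA: "card A > 0" using A by (simp add: card_gt_0_iff)
  \<comment> \<open>As \<open>L\<close> is even, an odd coordinate is never on the boundary, and
    both its neighbours stay in the cube.\<close>
  have odd_bound: "\<bar>e\<bar> < L" if "odd e" "\<bar>e\<bar> \<le> L" for e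
    using that L by (cases "\<bar>e\<bar> = L") (auto simp: abs_if split: if_splits)
  \<comment> \<open>All free coordinates of a full-dimensional cell are odd, whereas a boundary
    facet freezes one of them at the even number \<open>L\<close> or \<open>-L\<close>.\<close>
  have B0: "?B = {}" if ne: "i \<noteq> card A"
  proof -
    obtain x where x: "x \<in> T" "?r x = card A" using ex[of "card A"] ne by auto
    then have "odds A x = A" using A by (intro card_subset_eq) (auto simp: odds_def)
    then have "odd (x a)" if "a \<in> A" for a using that by (auto simp: odds_def)
    moreover have "x a = s" if "T \<in> flags L (A - {a}) (w(a := s)) (card A)" for a s
      using that x(1) face_fixed[of x L "A - {a}" "w(a := s)" a] by (auto simp: flags_def)
    ultimately have "odd s" if "a \<in> A" "T \<in> flags L (A - {a}) (w(a := s)) (card A)" for a s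
      using that by metis
    then show ?thesis using L by fastforce
  qed
  show ?thesis
  proof (cases "i = card A")
    case False
    have "card ?Z = 2"
    proof (cases "i = 0")
      \<comment> \<open>No vertex of the grid in \<open>T\<close>: the smallest cell is an edge
        \<open>y\<close>, and its two end points are the completions.\<close>
      case True
      obtain y where y: "y \<in> T" "?r y = 1" using ex[of 1] True cardA by auto
      obtain a where a: "odds A y = {a}" using y(2) by (rule card_1_singletonE)
      have aA: "a \<in> A" "odd (y a)" and yev: "\<And>c. c \<in> A \<Longrightarrow> c \<noteq> a \<Longrightarrow> even (y c)"
        using a by (auto simp: odds_def)
      have yf: "y \<in> face L A w" using y Tf by auto
      have "?Z = {y(a := y a - 1), y(a := y a + 1)}"
      proof (intro equalityI subsetI)
        fix z assume z: "z \<in> ?Z"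
        have "fle z y" using Zcmp[OF z y(1)] Zi[OF z] True by simp
        have "odds A z = {}" using Zi[OF z] True finodds by simp
        have "z c = y c" if "c \<noteq> a" for c
          using that yev[of c] fle_even[OF \<open>fle z y\<close>, of c] face_fixed[OF yf, of c] face_fixed[OF fZ[OF z], of c]
          by (cases "c \<in> A") auto
        then have "z = y(a := z a)" by auto
        moreover have "z a = y a - 1 \<or> z a = y a + 1"
          using \<open>fle z y\<close> \<open>odds A z = {}\<close> aA unfolding fle_def odds_def by (smt (verit) mem_Collect_eq empty_iff)
        ultimately show "z \<in> {y(a := y a - 1), y(a := y a + 1)}" by (metis insertCI)
      next
        fix z assume "z \<in> {y(a := y a - 1), y(a := y a + 1)}"
        then obtain e where e: "z = y(a := y a + e)" "\<bar>e\<bar> = 1" by force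
        have "\<bar>y a\<bar> < L" using odd_bound aA face_bound[OF yf] by blast
        then have "\<bar>y a + e\<bar> \<le> L" using e by linarith
        then have "z \<in> face L A w" using yf aA by (auto simp: face_def e)
        moreover have "fle z y" using e aA by (auto simp: fle_def)
        moreover have "odd e" using e by (auto simp: abs_if split: if_splits)
        then have "odds A z = {}" using yev aA by (auto simp: odds_def e)
        ultimately show "z \<in> ?Z"
        proof (intro ZI)
          fix t assume t: "t \<in> T"
          have "?r t \<noteq> 0" using ri[OF t] True by simp
          then have "fle y t" using cmp[OF y(1) t] y(2) by linarith
          then show "fle z t \<or> fle t z" using fle_trans[OF \<open>fle z y\<close>] by blast
        qed (use True in auto)
      qed
      moreover have "y(a := y a - 1) \<noteq> y(a := y a + 1)" by (metis add_cancel_right_right diff_eq_eq fun_upd_eqD add.assoc one_add_one zero_neq_numeral)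
      ultimately show ?thesis by simp
    next
      \<comment> \<open>Between cells \<open>x\<close> and \<open>y\<close> whose dimensions differ
        by 2 there are exactly two cells, obtained by opening one of the two directions
        \<open>a\<close> and \<open>b\<close>.\<close>
      case i0: False
      have "i - 1 \<le> card A" "i - 1 \<noteq> i" "i + 1 \<le> card A" "i + 1 \<noteq> i" using i0 i(1) False by auto
      then obtain x y where x: "x \<in> T" "?r x = i - 1" and y: "y \<in> T" "?r y = i + 1"
        using ex by meson
      have xf: "x \<in> face L A w" and yf: "y \<in> face L A w" using x y Tf by auto
      have xy: "fle x y" using cmp x y by simp
      then have sub: "odds A x \<subseteq> odds A y" by (rule fle_odds_subset)
      have "card (odds A y - odds A x) = 2" using x y i0 sub by (subst card_Diff_subset) (auto simp: finodds)
      then obtain a b where ab: "odds A y - odds A x = {a, b}" "a \<noteq> b" by (meson card_2_iff)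
      have upd: "x(c := y c) \<in> ?Z" if c: "c \<in> odds A y - odds A x" for c
      proof (rule ZI)
        have cA: "c \<in> A" "odd (y c)" "even (x c)" using c by (auto simp: odds_def)
        show "x(c := y c) \<in> face L A w" using xf face_bound[OF yf cA(1)] cA by (auto simp: face_def)
        have "odds A (x(c := y c)) = insert c (odds A x)" using cA by (auto simp: odds_def)
        then show "?r (x(c := y c)) = i" using c x i0 by (simp add: finodds)
        fix t assume t: "t \<in> T"
        have 1: "fle x (x(c := y c))" "fle (x(c := y c)) y"
          using xy by (auto simp: fle_def)
        have "?r t \<le> i - 1 \<or> i + 1 \<le> ?r t" using ri[OF t] by linarith
        then show "fle (x(c := y c)) t \<or> fle t (x(c := y c))"
          using cmp[OF t x(1)] cmp[OF y(1) t] fle_trans 1 x y by metis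
      qed
      have "?Z = {x(a := y a), x(b := y b)}"
      proof (intro equalityI subsetI)
        fix z assume z: "z \<in> ?Z"
        have xz: "fle x z" using Zcmp[OF z x(1)] Zi[OF z] x by simp
        have zy: "fle z y" using Zcmp[OF z y(1)] Zi[OF z] y by simp
        have s: "odds A x \<subseteq> odds A z" "odds A z \<subseteq> odds A y" using xz zy by (auto dest: fle_odds_subset)
        have "card (odds A z - odds A x) = 1" using Zi[OF z] x i0 s by (subst card_Diff_subset) (auto simp: finodds)
        then obtain c where c: "odds A z - odds A x = {c}" by (rule card_1_singletonE)
        then have "odds A z = insert c (odds A x)" using s by auto
        then have "z = x(c := z c)" using fle_insert_odds[OF xz _ xf fZ[OF z]] by simp
        moreover have "z c = y c" using c fle_odd[OF zy, of c] by (auto simp: odds_def)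
        moreover have "c = a \<or> c = b" using c s ab by blast
        ultimately show "z \<in> {x(a := y a), x(b := y b)}" by (metis insertCI)
      qed (use upd ab in blast)
      moreover have "x(a := y a) \<noteq> x(b := y b)"
      proof
        assume "x(a := y a) = x(b := y b)"
        from fun_cong[OF this, of a] have "x a = y a" using ab(2) by simp
        moreover have "a \<in> odds A y - odds A x" using ab by blast
        ultimately show False by (auto simp: odds_def)
      qed
      ultimately show ?thesis by simp
    qed
    moreover have "card ?B = 0" unfolding B0[OF False] by simp
    ultimately have "card ?Z + card ?B = 2" by linarith
    then show ?thesis by (simp only: even_numeral)
  next
    \<comment> \<open>No top cell in \<open>T\<close>: the completions are the full-dimensional
      cells with facet \<open>x\<close>. There are two of them, except when \<open>x\<close> lies on
      the boundary of the cube; then there is one, and \<open>T\<close> lies in that boundary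
      facet.\<close>
    case True
    have "card A - 1 \<le> card A" "card A - 1 \<noteq> i" using True cardA by auto
    then obtain x where x: "x \<in> T" "?r x = card A - 1" using ex by meson
    have xf: "x \<in> face L A w" using x Tf by auto
    have "card (A - odds A x) = 1"
      using x cardA by (subst card_Diff_subset) (auto simp: odds_def A)
    then obtain a where a: "A - odds A x = {a}" by (rule card_1_singletonE)
    have aA: "a \<in> A" "even (x a)" and xodd: "\<And>c. c \<in> A \<Longrightarrow> c \<noteq> a \<Longrightarrow> odd (x c)"
      using a by (auto simp: odds_def)
    have le: "fle t x" if t: "t \<in> T" for t
    proof -
      have "?r t \<le> card A - 1" using ri[OF t] True card_odds_le[OF A(1), of t] by linarith
      then show ?thesis using cmp[OF t x(1)] x by simp
    qed
    have Z: "?Z = (\<lambda>e. x(a := x a + e)) ` {e. \<bar>e\<bar> = 1 \<and> \<bar>x a + e\<bar> \<le> L}" (is "_ = ?E")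
    proof (intro equalityI subsetI)
      fix z assume z: "z \<in> ?Z"
      have "odds A z = A" using Zi[OF z] True A by (intro card_subset_eq) (auto simp: odds_def)
      moreover have "insert a (odds A x) = A" using a by (auto simp: odds_def)
      moreover have xz: "fle x z" using Zcmp[OF z x(1)] Zi[OF z] x True by simp
      ultimately have "z = x(a := z a)" using fle_insert_odds[OF xz _ xf fZ[OF z], of a] by simp
      moreover have "\<bar>z a - x a\<bar> = 1"
        using xz \<open>odds A z = A\<close> aA unfolding fle_def odds_def by (smt (verit) mem_Collect_eq)
      moreover have "\<bar>x a + (z a - x a)\<bar> \<le> L" using face_bound[OF fZ[OF z] aA(1)] by simp
      ultimately show "z \<in> ?E" by (intro image_eqI[of _ _ "z a - x a"]) auto
    next
      fix z assume "z \<in> ?E"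
      then obtain e where e: "z = x(a := x a + e)" "\<bar>e\<bar> = 1" "\<bar>x a + e\<bar> \<le> L" by blast
      have "odd e" using e by (auto simp: abs_if split: if_splits)
      show "z \<in> ?Z"
      proof (rule ZI)
        show "z \<in> face L A w" using xf aA e by (auto simp: face_def)
        have "odds A z = A" using xodd aA \<open>odd e\<close> by (auto simp: odds_def e)
        then show "?r z = i" using True by simp
        fix t assume "t \<in> T"
        have "fle x z" using e aA \<open>odd e\<close> by (auto simp: fle_def)
        then show "fle z t \<or> fle t z" using fle_trans[OF le[OF \<open>t \<in> T\<close>]] by blast
      qed
    qed
    have cardZ: "card ?Z = card {e. \<bar>e\<bar> = 1 \<and> \<bar>x a + e\<bar> \<le> L}"
      unfolding Z by (rule card_image) (auto intro!: inj_onI dest: fun_upd_eqD)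
    have Bsub: "b = a \<and> s = x a" if "(b, s) \<in> ?B" for b s
    proof -
      have "x b = s" using that x(1) face_fixed[of x L "A - {b}" "w(b := s)" b] by (auto simp: flags_def)
      moreover have "even s" "b \<in> A" using that L by auto
      ultimately show ?thesis using xodd by blast
    qed
    show ?thesis
    proof (cases "\<bar>x a\<bar> = L")
      case True
      have "(a, x a) \<in> ?B"
      proof -
        have "t \<in> face L (A - {a}) (w(a := x a))" if "t \<in> T" for t
          using fle_even[OF le[OF that] aA(2)] Tf that by (auto simp: face_def)
        then show ?thesis using T aA True by (auto simp: flags_def)
      qed
      moreover have "?B \<subseteq> {(a, x a)}"
      proof (rule subrelI)
        fix b s assume "(b, s) \<in> ?B"
        from Bsub[OF this] show "(b, s) \<in> {(a, x a)}" by simp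
      qed
      ultimately have "?B = {(a, x a)}" by (intro equalityI) (simp_all only: insert_subset empty_subsetI simp_thms)
      from arg_cong[OF this, of card] have "card ?B = 1" by (rule trans) simp
      moreover have "{e. \<bar>e\<bar> = 1 \<and> \<bar>x a + e\<bar> \<le> L} = {- sgn (x a)}"
        using True L by (auto simp: abs_if sgn_if split: if_splits)
      then have "card ?Z = 1" unfolding cardZ by simp
      ultimately have "card ?Z + card ?B = 2" by linarith
      then show ?thesis by (simp only: even_numeral)
    next
      case False
      have "?B = {}"
      proof (rule equals0I)
        fix p assume p: "p \<in> ?B"
        obtain b s where bs: "p = (b, s)" by (cases p)
        have "x a = s" using Bsub[of b s] p unfolding bs by simp
        moreover have "\<bar>s\<bar> = L" using p L unfolding bs by auto
        ultimately show False using False by simp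
      qed
      then have "card ?B = 0" by (simp only: card.empty)
      moreover have "\<bar>x a\<bar> < L" using False face_bound[OF xf aA(1)] by simp
      then have "{e. \<bar>e\<bar> = 1 \<and> \<bar>x a + e\<bar> \<le> L} = {-1, 1}" by auto
      then have "card ?Z = 2" unfolding cardZ by simp
      ultimately have "card ?Z + card ?B = 2" by linarith
      then show ?thesis by (simp only: even_numeral)
    qed
  qed
qed

lemma sum_card_swap:
  "finite A \<Longrightarrow> finite B \<Longrightarrow> (\<Sum>x\<in>A. card {y\<in>B. R x y}) = (\<Sum>y\<in>B. card {x\<in>A. R x y})"
  unfolding card_eq_sum by (rule sum.swap_restrict)

text \<open>A mod 2 Stokes theorem: pairs of a maximal simplex and one of its facets are counted by
  the facet, and facets off the boundary contribute even numbers.\<close>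

lemma sum_max_flags_parity:
  assumes A: "finite A" "A \<noteq> {}" and L: "even L" "L > 0"
  shows "even ((\<Sum>S\<in>flags L A w (Suc (card A)). card {u\<in>S. \<Phi> (S - {u})}) +
    (\<Sum>a\<in>A. \<Sum>s\<in>{L, -L}. card {T\<in>flags L (A - {a}) (w(a := s)) (card A). \<Phi> T}))"
proof -
  let ?M = "flags L A w (Suc (card A))" and ?F = "{T\<in>flags L A w (card A). \<Phi> T}"
  let ?Z = "\<lambda>T. {z \<in> face L A w - T. insert z T \<in> ?M}"
  let ?B = "\<lambda>T. {(a, s) \<in> A \<times> {L, -L}. T \<in> flags L (A - {a}) (w(a := s)) (card A)}"
  have fin: "finite ?F" using A by (simp add: finite_flags)
  have finface: "finite (face L A w)" using A by (simp add: finite_face)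
  have "(\<Sum>S\<in>?M. card {u\<in>S. \<Phi> (S - {u})}) = card (SIGMA S:?M. {u\<in>S. \<Phi> (S - {u})})"
    by (subst card_SigmaI) (auto simp: finite_flags A dest: flags_finite[OF A(1)])
  also have "\<dots> = card (SIGMA T:?F. ?Z T)"
  proof (rule bij_betw_same_card)
    show "bij_betw (\<lambda>(S, u). (S - {u}, u)) (SIGMA S:?M. {u\<in>S. \<Phi> (S - {u})}) (SIGMA T:?F. ?Z T)"
    proof (rule bij_betw_byWitness[where f' = "\<lambda>(T, z). (insert z T, z)"])
      show "(\<lambda>(S, u). (S - {u}, u)) ` (SIGMA S:?M. {u\<in>S. \<Phi> (S - {u})}) \<subseteq> (SIGMA T:?F. ?Z T)"
        using flags_finite[OF A(1)] by (auto simp: insert_absorb flags_def)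
    next
      show "(\<lambda>(T, z). (insert z T, z)) ` (SIGMA T:?F. ?Z T) \<subseteq> (SIGMA S:?M. {u\<in>S. \<Phi> (S - {u})})"
        by auto
    qed (auto simp: insert_absorb)
  qed
  also have "\<dots> = (\<Sum>T\<in>?F. card (?Z T))"
    by (subst card_SigmaI) (auto simp: fin intro: finite_subset[OF _ finface])
  finally have 1: "(\<Sum>S\<in>?M. card {u\<in>S. \<Phi> (S - {u})}) = (\<Sum>T\<in>?F. card (?Z T))" .
  have "(\<Sum>a\<in>A. \<Sum>s\<in>{L, -L}. card {T\<in>flags L (A - {a}) (w(a := s)) (card A). \<Phi> T}) =
      (\<Sum>(a, s)\<in>A \<times> {L, -L}. card {T\<in>flags L (A - {a}) (w(a := s)) (card A). \<Phi> T})"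
    by (simp add: sum.cartesian_product)
  also have "\<dots> = (\<Sum>(a, s)\<in>A \<times> {L, -L}. card {T\<in>?F. T \<in> flags L (A - {a}) (w(a := s)) (card A)})"
  proof (intro sum.cong refl, clarify)
    fix a s assume "a \<in> A" "s \<in> {L, -L}"
    then have "face L (A - {a}) (w(a := s)) \<subseteq> face L A w"
      using L by (fastforce simp: face_def)
    then have "{T\<in>flags L (A - {a}) (w(a := s)) (card A). \<Phi> T} =
      {T\<in>?F. T \<in> flags L (A - {a}) (w(a := s)) (card A)}" by (auto simp: flags_def)
    then show "card {T\<in>flags L (A - {a}) (w(a := s)) (card A). \<Phi> T} =
      card {T\<in>?F. T \<in> flags L (A - {a}) (w(a := s)) (card A)}" by simp
  qed
  also have "\<dots> = (\<Sum>T\<in>?F. card (?B T))"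
  proof -
    have "(\<Sum>p\<in>A \<times> {L, -L}. card {T\<in>?F. T \<in> flags L (A - {fst p}) (w(fst p := snd p)) (card A)}) =
      (\<Sum>T\<in>?F. card {p\<in>A \<times> {L, -L}. T \<in> flags L (A - {fst p}) (w(fst p := snd p)) (card A)})"
      by (intro sum_card_swap fin finite_cartesian_product A) simp
    then show ?thesis by (simp only: case_prod_unfold prod.collapse)
  qed
  finally have 2: "(\<Sum>a\<in>A. \<Sum>s\<in>{L, -L}. card {T\<in>flags L (A - {a}) (w(a := s)) (card A). \<Phi> T}) =
    (\<Sum>T\<in>?F. card (?B T))" .
  have "even (\<Sum>T\<in>?F. card (?Z T) + card (?B T))"
    by (intro dvd_sum even_completions_add_facets) (use A L in auto)
  then show ?thesis unfolding 1 2 by (simp add: sum.distrib)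
qed

section \<open>Counting zeros on products of spheres\<close>

definition flip :: "nat \<Rightarrow> (nat \<times> nat \<Rightarrow> 'a::uminus) \<Rightarrow> nat \<times> nat \<Rightarrow> 'a"
  where "flip j x = (\<lambda>c. if fst c = j then - x c else x c)"

text \<open>A grid point is indexed by pairs (block, position). From position \<open>t\<close> of block \<open>j\<close> on, \<open>rho\<close>
  has the opposite sign of the alternating pattern. The two facets of an alternating face in the
  direction \<open>(j, i)\<close> are \<open>rho\<close> at \<open>i\<close> and at \<open>i + 1\<close>, so sums over boundary facets telescope mod 2.\<close>

definition rho :: "int \<Rightarrow> (nat \<times> nat) set \<Rightarrow> nat \<Rightarrow> nat \<Rightarrow> nat \<times> nat \<Rightarrow> int"
  where "rho L I j t = (\<lambda>c. if c \<in> I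
    then L * (-1) ^ (card {i. i < snd c \<and> (fst c, i) \<in> I} + of_bool (fst c = j \<and> t \<le> snd c)) else 0)"

text \<open>Starting with \<open>+L\<close> singles out one of two antipodal patterns in each block.
  For a single block, the mod 2 boundary of the sum of alternating faces with \<open>s\<close> fixed
  coordinates is the sum of those with \<open>s + 1\<close>, together with their antipodes.\<close>

definition alternating :: "int \<Rightarrow> (nat \<times> nat) set \<Rightarrow> nat \<times> nat \<Rightarrow> int"
  where "alternating L I = (\<lambda>c. if c \<in> I then L * (-1) ^ card {i. i < snd c \<and> (fst c, i) \<in> I} else 0)"

lemma flip_flip [simp]: "flip j (flip j x) = (x :: nat \<times> nat \<Rightarrow> 'a::group_add)"
  by (auto simp: flip_def)

lemma rho_0: "rho L I j 0 = flip j (alternating L I)"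
  by (auto simp: rho_def flip_def alternating_def)

lemma rho_top: "(\<And>i. (j, i) \<in> I \<Longrightarrow> i < t) \<Longrightarrow> rho L I j t = alternating L I"
  by (force simp: rho_def alternating_def)

lemma rho_Suc_eq: "(j, i) \<notin> I \<Longrightarrow> rho L I j (Suc i) = rho L I j i"
proof -
  assume "(j, i) \<notin> I"
  then have "(fst c = j \<and> Suc i \<le> snd c) = (fst c = j \<and> i \<le> snd c)" if "c \<in> I" for c
    using that by (cases c) (auto simp: Suc_le_eq le_less)
  then show ?thesis by (auto simp: rho_def)
qed

lemma rho_remove:
  assumes "(j, i) \<in> I"
  shows "(alternating L (I - {(j, i)}))((j, i) := rho L I j i (j, i)) = rho L I j i" (is ?A)
    and "(alternating L (I - {(j, i)}))((j, i) := rho L I j (Suc i) (j, i)) = rho L I j (Suc i)" (is ?B)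
proof -
  have *: "alternating L (I - {(j, i)}) c = rho L I j t c"
    if c: "c \<noteq> (j, i)" and t: "t = i \<or> t = Suc i" for c t
  proof (cases "c \<in> I")
    case True
    show ?thesis
    proof (cases "fst c = j \<and> i < snd c")
      case True
      have "{i'. i' < snd c \<and> (fst c, i') \<in> I - {(j, i)}} = {i'. i' < snd c \<and> (fst c, i') \<in> I} - {i}"
        using True by auto
      moreover have "i \<in> {i'. i' < snd c \<and> (fst c, i') \<in> I}" using True assms by auto
      ultimately have "card {i'. i' < snd c \<and> (fst c, i') \<in> I} =
          Suc (card {i'. i' < snd c \<and> (fst c, i') \<in> I - {(j, i)}})"
        using card.remove[of "{i'. i' < snd c \<and> (fst c, i') \<in> I}" i] by simp
      moreover have "of_bool (fst c = j \<and> t \<le> snd c) = (1 :: nat)" using True t by auto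
      moreover have "c \<in> I - {(j, i)}" using c \<open>c \<in> I\<close> by simp
      ultimately show ?thesis using \<open>c \<in> I\<close> by (simp only: alternating_def rho_def if_True) simp
    next
      case False
      have "{i'. i' < snd c \<and> (fst c, i') \<in> I - {(j, i)}} = {i'. i' < snd c \<and> (fst c, i') \<in> I}"
        using False by auto
      moreover have "\<not> (fst c = j \<and> t \<le> snd c)" using False c t by (cases c) auto
      moreover have "c \<in> I - {(j, i)}" using c \<open>c \<in> I\<close> by simp
      ultimately show ?thesis using \<open>c \<in> I\<close> by (simp only: alternating_def rho_def if_True) simp
    qed
  qed (auto simp: alternating_def rho_def)
  show ?A ?B using * by (auto simp: fun_eq_iff)
qed

lemma sum_signs_rho:
  fixes X :: "(nat \<times> nat \<Rightarrow> int) \<Rightarrow> nat"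
  assumes "(j, i) \<in> I" "L > 0"
  shows "(\<Sum>s\<in>{L, -L}. X ((alternating L (I - {(j, i)}))((j, i) := s))) =
    X (rho L I j i) + X (rho L I j (Suc i))"
proof -
  let ?n = "card {i'. i' < i \<and> (j, i') \<in> I}"
  have "rho L I j i (j, i) = - (L * (-1) ^ ?n)" "rho L I j (Suc i) (j, i) = L * (-1) ^ ?n"
    using assms(1) by (auto simp: rho_def)
  then have "{L, -L} = {rho L I j i (j, i), rho L I j (Suc i) (j, i)}"
    "rho L I j i (j, i) \<noteq> rho L I j (Suc i) (j, i)"
    using assms(2) by (cases "even ?n"; auto)+
  then show ?thesis by (simp add: rho_remove[OF assms(1)])
qed

lemma even_sum_cong: "(\<And>x. x \<in> A \<Longrightarrow> even (f x) = even (g x)) \<Longrightarrow> even (sum f A) = even (sum g A :: nat)"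
  by (induction A rule: infinite_finite_induct) auto

lemma even_telescope: "even (\<Sum>i<n. f i + f (Suc i)) = even (f 0 + f n :: nat)"
  by (induction n) auto

lemma even_sum_of_bool_cong:
  "(\<And>x. x \<in> A \<Longrightarrow> P x = odd (g x)) \<Longrightarrow> finite A \<Longrightarrow> even (card {x\<in>A. P x}) = even (sum g A :: nat)"
proof -
  assume P: "\<And>x. x \<in> A \<Longrightarrow> P x = odd (g x)" and "finite A"
  have "card {x\<in>A. P x} = (\<Sum>x\<in>A. of_bool (P x))" using \<open>finite A\<close> by (simp add: sum.If_cases of_bool_def Int_def)
  also have "even \<dots> = even (sum g A)" using P by (intro even_sum_cong) auto
  finally show ?thesis .
qed

lemma fle_flip: "fle x y \<Longrightarrow> fle (flip j x) (flip j y)"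
  unfolding fle_def flip_def by (auto simp: abs_minus_commute)

lemma flip_flags: "T \<in> flags L A w r \<Longrightarrow> flip j ` T \<in> flags L A (flip j w) r"
proof -
  assume T: "T \<in> flags L A w r"
  have "inj_on (flip j) T" by (rule inj_on_inverseI[of _ "flip j"]) simp
  moreover have "flip j x \<in> face L A (flip j w)" if "x \<in> face L A w" for x
    using that by (simp add: face_def flip_def)
  moreover have "fle (flip j x) (flip j y) \<or> fle (flip j y) (flip j x)" if "x \<in> T" "y \<in> T" for x y
    using T that fle_flip unfolding flags_def by blast
  ultimately show ?thesis using T by (auto simp: flags_def card_image)
qed

lemma bij_betw_flip_flags: "bij_betw ((`) (flip j)) (flags L A w r) (flags L A (flip j w) r)"
proof (rule bij_betw_byWitness[where f' = "(`) (flip j)"])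
  show "(`) (flip j) ` flags L A (flip j w) r \<subseteq> flags L A w r"
    using flip_flags[of _ L A "flip j w" r j] by auto
qed (auto simp: image_image flip_flags)

text \<open>\<open>ch r\<close> is the set of blocks on which the character of \<open>f r\<close> is nontrivial. The assumption on
  \<open>step\<close> says that, processing the functions from the last to the first, \<open>step r\<close> is the only block
  of \<open>ch r\<close> with a free coordinate left.\<close>

locale signed_cube =
  fixes J :: "nat set" and d :: "nat \<Rightarrow> nat" and L :: int and D :: nat
    and ch :: "nat \<Rightarrow> nat set" and step :: "nat \<Rightarrow> nat" and f :: "nat \<Rightarrow> (nat \<times> nat \<Rightarrow> int) \<Rightarrow> real"
  assumes J: "finite J" and L: "even L" "L > 0"
    and gen: "\<And>T r. T \<in> flags L (SIGMA j:J. {..<d j}) (\<lambda>_. 0) r \<Longrightarrow> generic f D T"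
    and equi: "\<And>r x j. r < D \<Longrightarrow> x \<in> face L (SIGMA j:J. {..<d j}) (\<lambda>_. 0) \<Longrightarrow> j \<in> J \<Longrightarrow>
      \<exists>i<d j. \<bar>x (j, i)\<bar> = L \<Longrightarrow> f r (flip j x) = (if j \<in> ch r then - f r x else f r x)"
    and step: "\<And>t. t < D \<Longrightarrow> step t \<in> J" and d_card: "\<And>j. j \<in> J \<Longrightarrow> d j = card {t. t < D \<and> step t = j}"
    and ch: "\<And>r. r < D \<Longrightarrow> ch r \<inter> step ` {..r} = {step r}"
begin

abbreviation "C \<equiv> SIGMA j:J. {..<d j}"
abbreviation "alt \<equiv> alternating L"

definition E :: "(nat \<Rightarrow> nat) \<Rightarrow> (nat \<times> nat) set set"
  where "E s = {I. I \<subseteq> C \<and> (\<forall>j\<in>J. card {i. (j, i) \<in> I} = s j)}"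

text \<open>Used when the numbers \<open>s j\<close> add up to \<open>card C - r\<close>: the faces
  then have dimension \<open>r\<close>, and the flags are their maximal simplices. The parity plays
  the role of the mod 2 count of zeros of the first \<open>r\<close> functions, up to sign changes,
  on a product of subspheres of codimension \<open>s j\<close>.\<close>

definition total :: "nat \<Rightarrow> (nat \<Rightarrow> nat) \<Rightarrow> nat"
  where "total r s = (\<Sum>I\<in>E s. card {T\<in>flags L (C - I) (alt I) (Suc r). zero_in f r T})"

lemma finite_C: "finite C" using J by simp

lemma finite_E: "finite (E s)"
  by (rule finite_subset[of _ "Pow C"]) (auto simp: E_def finite_C)

lemma card_E: "I \<in> E s \<Longrightarrow> card I = (\<Sum>j\<in>J. s j)"
proof -
  assume I: "I \<in> E s"
  then have eq: "I = (SIGMA j:J. {i. (j, i) \<in> I})" by (auto simp: E_def)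
  have "finite {i. (j, i) \<in> I}" for j
    by (rule finite_subset[of _ "{..<d j}"]) (use I in \<open>auto simp: E_def\<close>)
  then have "card I = (\<Sum>j\<in>J. card {i. (j, i) \<in> I})"
    using J by (intro trans[OF arg_cong[OF eq, of card]] card_SigmaI) auto
  then show ?thesis using I by (simp add: E_def)
qed

lemma alternating_abs: "c \<in> I \<Longrightarrow> \<bar>alt I c\<bar> = L"
  using L by (simp add: alternating_def abs_mult power_abs)

lemma alt_face_subset: "I \<subseteq> C \<Longrightarrow> face L (C - I) (alt I) \<subseteq> face L C (\<lambda>_. 0)"
proof
  fix x assume I: "I \<subseteq> C" and x: "x \<in> face L (C - I) (alt I)"
  have "if c \<in> C then \<bar>x c\<bar> \<le> L else x c = 0" for c
    using face_bound[OF x, of c] face_fixed[OF x, of c] alternating_abs[of c I] I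
    by (cases "c \<in> I") (auto simp: alternating_def)
  then show "x \<in> face L C (\<lambda>_. 0)" by (simp add: face_def)
qed

lemma alt_flags: "I \<subseteq> C \<Longrightarrow> T \<in> flags L (C - I) (alt I) r \<Longrightarrow> T \<in> flags L C (\<lambda>_. 0) r"
  using alt_face_subset[of I] by (auto simp: flags_def)

lemma generic_alt:
  assumes "I \<subseteq> C" "T \<in> flags L (C - I) (alt I) r" "q \<le> D"
  shows "generic f q T"
proof -
  have "generic f D T" using gen alt_flags assms by blast
  then show ?thesis using assms(3) unfolding generic_def by (meson order_trans)
qed

text \<open>The fixed coordinate in block \<open>j\<close> has modulus \<open>L\<close> on the whole
  face, so equivariance applies at every vertex. Sign changes do not affect the vanishing of the
  first \<open>r\<close> functions, and \<open>ch r\<close> decides about the next one.\<close>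

lemma neg_in_flip:
  assumes I: "I \<subseteq> C" and T: "T \<in> flags L (C - I) (alt I) m" and j: "j \<in> J" "(j, i) \<in> I" and r: "r < D"
  shows "neg_in f r (flip j ` T) \<longleftrightarrow> (if j \<in> ch r then pos_in f r T else neg_in f r T)"
proof -
  have inj: "inj_on (flip j) T" by (rule inj_on_inverseI[of _ "flip j"]) simp
  have eq: "f q (flip j x) = (if j \<in> ch q then -1 else 1) * f q x" if "q \<le> r" "x \<in> T" for q x
  proof -
    have x: "x \<in> face L (C - I) (alt I)" using T that by (auto simp: flags_def)
    then have "\<bar>x (j, i)\<bar> = L" using face_fixed[OF x, of "(j, i)"] alternating_abs j by auto
    moreover have "i < d j" using I j by auto
    ultimately have ex: "\<exists>i<d j. \<bar>x (j, i)\<bar> = L" by blast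
    have "x \<in> face L C (\<lambda>_. 0)" using x alt_face_subset[OF I] by blast
    then show ?thesis using equi[OF _ _ j(1) ex, of q] that r by simp
  qed
  have sum: "(\<Sum>v\<in>flip j ` T. b v * f q v) = (if j \<in> ch q then -1 else 1) * (\<Sum>v\<in>T. b (flip j v) * f q v)"
    if "q \<le> r" for b q
    using that inj by (simp add: sum.reindex eq sum_negf)
  have null: "null_comb f r (flip j ` T) b \<longleftrightarrow> null_comb f r T (\<lambda>v. b (flip j v))" for b
    unfolding null_comb_def by (auto simp: sum)
  have "neg_in f r (flip j ` T) \<longleftrightarrow> (\<exists>b. (\<forall>v\<in>T. b (flip j v) > 0) \<and> null_comb f r T (\<lambda>v. b (flip j v)) \<and>
      (if j \<in> ch r then -1 else 1) * (\<Sum>v\<in>T. b (flip j v) * f r v) < 0)"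
    unfolding neg_in_def by (simp add: null sum)
  also have "\<dots> \<longleftrightarrow> (\<exists>b. (\<forall>v\<in>T. b v > 0) \<and> null_comb f r T b \<and>
      (if j \<in> ch r then -1 else 1) * (\<Sum>v\<in>T. b v * f r v) < 0)" (is "?l = ?r")
  proof
    assume ?l
    then obtain b where "(\<forall>v\<in>T. b (flip j v) > 0) \<and> null_comb f r T (\<lambda>v. b (flip j v)) \<and>
      (if j \<in> ch r then -1 else 1) * (\<Sum>v\<in>T. b (flip j v) * f r v) < 0" by blast
    then show ?r by (intro exI[of _ "\<lambda>v. b (flip j v)"])
  next
    assume ?r
    then obtain b where "(\<forall>v\<in>T. b v > 0) \<and> null_comb f r T b \<and>
      (if j \<in> ch r then -1 else 1) * (\<Sum>v\<in>T. b v * f r v) < 0" by blast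
    then show ?l by (intro exI[of _ "\<lambda>v. b (flip j v)"]) simp
  qed
  finally show ?thesis by (simp add: neg_in_def pos_in_def)
qed

text \<open>If \<open>j\<close> lies in \<open>ch r\<close>, negative zeros on the flipped face are
  positive zeros on the original one, and the two signs together account for all zeros. Otherwise
  the two counts agree and cancel mod 2.\<close>

lemma neg_count_flip:
  assumes I: "I \<subseteq> C" "card (C - I) = r" and j: "j \<in> J" "(j, i) \<in> I" and r: "r < D"
  shows "even (card {T\<in>flags L (C - I) (flip j (alt I)) (Suc r). neg_in f r T} +
      card {T\<in>flags L (C - I) (alt I) (Suc r). neg_in f r T}) =
    even (if j \<in> ch r then card {T\<in>flags L (C - I) (alt I) (Suc r). zero_in f r T} else 0)"
proof -
  let ?F = "flags L (C - I) (alt I) (Suc r)"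
  have "card {T\<in>flags L (C - I) (flip j (alt I)) (Suc r). neg_in f r T} =
    card {T\<in>?F. neg_in f r (flip j ` T)}"
  proof (rule bij_betw_same_card[symmetric])
    show "bij_betw ((`) (flip j)) {T\<in>?F. neg_in f r (flip j ` T)}
      {T\<in>flags L (C - I) (flip j (alt I)) (Suc r). neg_in f r T}"
      by (rule bij_betw_Collect[OF bij_betw_flip_flags]) simp
  qed
  also have "{T\<in>?F. neg_in f r (flip j ` T)} =
      {T\<in>?F. if j \<in> ch r then pos_in f r T else neg_in f r T}"
    using neg_in_flip[OF I(1) _ j r] by blast
  finally have 1: "card {T\<in>flags L (C - I) (flip j (alt I)) (Suc r). neg_in f r T} =
      card {T\<in>?F. if j \<in> ch r then pos_in f r T else neg_in f r T}" .
  show ?thesis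
  proof (cases "j \<in> ch r")
    case True
    have fin: "finite ?F" by (intro finite_flags) (simp add: finite_C)
    have T: "card T = Suc r" "generic f (Suc r) T" if "T \<in> ?F" for T
      using that generic_alt[OF I(1) that, of "Suc r"] r by (auto simp: flags_def)
    have "{T\<in>?F. zero_in f r T} = {T\<in>?F. pos_in f r T} \<union> {T\<in>?F. neg_in f r T}"
      using zero_in_iff_neg_or_pos[OF T] by blast
    moreover have "{T\<in>?F. pos_in f r T} \<inter> {T\<in>?F. neg_in f r T} = {}"
      using not_neg_and_pos[OF T] by blast
    ultimately have "card {T\<in>?F. zero_in f r T} = card {T\<in>?F. pos_in f r T} + card {T\<in>?F. neg_in f r T}"
      using fin by (simp add: card_Un_disjoint)
    then show ?thesis using 1 True by simp
  qed (simp add: 1)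
qed

text \<open>The arc argument replaces zeros in a maximal simplex by negative zeros on its facets; of
  these, only the ones on the boundary of the face survive mod 2.\<close>

lemma zero_count_step:
  assumes I: "I \<in> E s" and s: "(\<Sum>j\<in>J. s j) + Suc r = card C" and r: "r < D"
  shows "even (card {T\<in>flags L (C - I) (alt I) (Suc (Suc r)). zero_in f (Suc r) T}) =
    even (\<Sum>b\<in>C-I. \<Sum>\<sigma>\<in>{L, -L}. card {T\<in>flags L (C - I - {b}) ((alt I)(b := \<sigma>)) (Suc r). neg_in f r T})"
proof -
  have sub: "I \<subseteq> C" using I by (simp add: E_def)
  have fin: "finite (C - I)" using finite_C by simp
  have card: "card (C - I) = Suc r"
    using card_E[OF I] s sub finite_C by (simp add: card_Diff_subset finite_subset)
  have "zero_in f (Suc r) T \<longleftrightarrow> odd (card {u\<in>T. neg_in f r (T - {u})})"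
    if T: "T \<in> flags L (C - I) (alt I) (Suc (Suc r))" for T
    by (rule zero_in_iff_odd_neg_facets)
       (use T flags_finite[OF fin T] generic_alt[OF sub T] r in \<open>auto simp: flags_def\<close>)
  then have "even (card {T\<in>flags L (C - I) (alt I) (Suc (Suc r)). zero_in f (Suc r) T}) =
    even (\<Sum>T\<in>flags L (C - I) (alt I) (Suc (Suc r)). card {u\<in>T. neg_in f r (T - {u})})"
    by (intro even_sum_of_bool_cong) (auto simp: finite_flags fin)
  also have "\<dots> = even (\<Sum>b\<in>C-I. \<Sum>\<sigma>\<in>{L, -L}. card {T\<in>flags L (C - I - {b}) ((alt I)(b := \<sigma>)) (Suc r). neg_in f r T})"
  proof -
    have "C - I \<noteq> {}" using card by force
    from sum_max_flags_parity[OF fin this L, where w = "alt I" and \<Phi> = "neg_in f r"]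
    show ?thesis unfolding card even_add .
  qed
  finally show ?thesis .
qed

text \<open>The effect of the function \<open>r\<close> is multiplication by the sum of
  \<open>h_j\<close> over \<open>j\<close> in \<open>ch r\<close>: the boundary facets, sorted by
  the block of the newly fixed coordinate, reduce to antipodal pairs.\<close>

lemma total_step:
  assumes s: "(\<Sum>j\<in>J. s j) + Suc r = card C" and r: "r < D"
  shows "even (total (Suc r) s) = even (\<Sum>j\<in>J\<inter>ch r. total r (s(j := Suc (s j))))"
proof -
  define Y where "Y I w = card {T\<in>flags L (C - I) w (Suc r). neg_in f r T}" for I w
  have "even (total (Suc r) s) =
      even (\<Sum>I\<in>E s. \<Sum>b\<in>C-I. \<Sum>\<sigma>\<in>{L, -L}. Y (insert b I) ((alt I)(b := \<sigma>)))"
    unfolding total_def Y_def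
    by (rule even_sum_cong) (subst zero_count_step[OF _ s r], auto simp flip: Diff_insert)
  also have "(\<Sum>I\<in>E s. \<Sum>b\<in>C-I. \<Sum>\<sigma>\<in>{L, -L}. Y (insert b I) ((alt I)(b := \<sigma>))) =
      (\<Sum>(I, b)\<in>(SIGMA I:E s. C - I). \<Sum>\<sigma>\<in>{L, -L}. Y (insert b I) ((alt I)(b := \<sigma>)))"
    using finite_E finite_C by (subst sum.Sigma) auto
  \<comment> \<open>Regroup by the enlarged set of fixed coordinates, which has one more element in
    block \<open>j\<close>.\<close>
  also have "\<dots> = (\<Sum>(j, I, i)\<in>(SIGMA j:J. SIGMA I:E (s(j := Suc (s j))). {i. i < d j \<and> (j, i) \<in> I}).
      \<Sum>\<sigma>\<in>{L, -L}. Y I ((alt (I - {(j, i)}))((j, i) := \<sigma>)))"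
  proof (rule sum.reindex_bij_witness[where
      i = "\<lambda>(j, I, i). (I - {(j, i)}, (j, i))" and j = "\<lambda>(I, b). (fst b, insert b I, snd b)"])
    fix p assume "p \<in> (SIGMA I:E s. C - I)"
    then obtain I j i where p: "p = (I, (j, i))" "I \<in> E s" "j \<in> J" "i < d j" "(j, i) \<notin> I" by auto
    have "insert (j, i) I \<in> E (s(j := Suc (s j)))"
    proof -
      have fin: "finite {i. (j, i) \<in> I}"
        by (rule finite_subset[of _ "{..<d j}"]) (use p in \<open>auto simp: E_def\<close>)
      have "{i'. (j', i') \<in> insert (j, i) I} =
          (if j' = j then insert i {i'. (j, i') \<in> I} else {i'. (j', i') \<in> I})" for j' by auto
      then show ?thesis using p fin by (auto simp: E_def)
    qed
    then show "(\<lambda>(I, b). (fst b, insert b I, snd b)) p \<in>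
      (SIGMA j:J. SIGMA I:E (s(j := Suc (s j))). {i. i < d j \<and> (j, i) \<in> I})" using p by simp
    show "(\<lambda>(j, I, i). (I - {(j, i)}, (j, i))) ((\<lambda>(I, b). (fst b, insert b I, snd b)) p) = p"
      using p by simp
    show "(case (\<lambda>(I, b). (fst b, insert b I, snd b)) p of (j, I, i) \<Rightarrow>
        \<Sum>\<sigma>\<in>{L, -L}. Y I ((alt (I - {(j, i)}))((j, i) := \<sigma>))) =
      (case p of (I, b) \<Rightarrow> \<Sum>\<sigma>\<in>{L, -L}. Y (insert b I) ((alt I)(b := \<sigma>)))"
      using p by simp
  next
    fix q assume "q \<in> (SIGMA j:J. SIGMA I:E (s(j := Suc (s j))). {i. i < d j \<and> (j, i) \<in> I})"
    then obtain j I i where q: "q = (j, I, i)" "j \<in> J" "I \<in> E (s(j := Suc (s j)))" "i < d j" "(j, i) \<in> I" by auto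
    have "I - {(j, i)} \<in> E s"
    proof -
      have fin: "finite {i. (j, i) \<in> I}"
        by (rule finite_subset[of _ "{..<d j}"]) (use q in \<open>auto simp: E_def\<close>)
      have "{i'. (j', i') \<in> I - {(j, i)}} =
          (if j' = j then {i'. (j, i') \<in> I} - {i} else {i'. (j', i') \<in> I})" for j' by auto
      then show ?thesis using q fin by (auto simp: E_def)
    qed
    then show "(\<lambda>(j, I, i). (I - {(j, i)}, (j, i))) q \<in> (SIGMA I:E s. C - I)" using q by simp
    show "(\<lambda>(I, b). (fst b, insert b I, snd b)) ((\<lambda>(j, I, i). (I - {(j, i)}, (j, i))) q) = q"
      using q by (simp add: insert_absorb)
  qed
  also have "\<dots> = (\<Sum>j\<in>J. \<Sum>I\<in>E (s(j := Suc (s j))). \<Sum>i | i < d j \<and> (j, i) \<in> I.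
      \<Sum>\<sigma>\<in>{L, -L}. Y I ((alt (I - {(j, i)}))((j, i) := \<sigma>)))"
    using J finite_E by (subst (1 2) sum.Sigma) auto
  also have "even \<dots> = even (\<Sum>j\<in>J. if j \<in> ch r then total r (s(j := Suc (s j))) else 0)"
  proof (rule even_sum_cong)
    fix j assume j: "j \<in> J"
    let ?E = "E (s(j := Suc (s j)))"
    have "even (\<Sum>I\<in>?E. \<Sum>i | i < d j \<and> (j, i) \<in> I. \<Sum>\<sigma>\<in>{L, -L}. Y I ((alt (I - {(j, i)}))((j, i) := \<sigma>))) =
      even (\<Sum>I\<in>?E. if j \<in> ch r then card {T\<in>flags L (C - I) (alt I) (Suc r). zero_in f r T} else 0)"
    proof (rule even_sum_cong)
      fix I assume I: "I \<in> ?E"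
      have sub: "I \<subseteq> C" and cj: "card {i. (j, i) \<in> I} = Suc (s j)" using I j by (auto simp: E_def)
      have "{i. (j, i) \<in> I} \<noteq> {}" using cj by force
      then obtain i0 where i0: "(j, i0) \<in> I" by blast
      have "(\<Sum>j'\<in>J. (s(j := Suc (s j))) j') = Suc (\<Sum>j\<in>J. s j)"
        using J j by (simp add: sum.remove[of J j])
      then have card: "card (C - I) = r"
        using card_E[OF I] s sub finite_C by (simp add: card_Diff_subset finite_subset)
      let ?y = "\<lambda>t. Y I (rho L I j t)"
      have "(\<Sum>i | i < d j \<and> (j, i) \<in> I. \<Sum>\<sigma>\<in>{L, -L}. Y I ((alt (I - {(j, i)}))((j, i) := \<sigma>))) =
        (\<Sum>i | i < d j \<and> (j, i) \<in> I. ?y i + ?y (Suc i))"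
        by (intro sum.cong refl sum_signs_rho) (use L in auto)
      also have "even \<dots> = even (\<Sum>i<d j. if (j, i) \<in> I then ?y i + ?y (Suc i) else 0)"
        by (simp add: sum.If_cases Int_def)
      \<comment> \<open>Positions outside \<open>I\<close> may be included: \<open>rho\<close> does
        not change there, and the two equal terms cancel mod 2.\<close>
      also have "\<dots> = even (\<Sum>i<d j. ?y i + ?y (Suc i))"
        by (rule even_sum_cong) (auto simp: rho_Suc_eq)
      also have "\<dots> = even (?y 0 + ?y (d j))" by (rule even_telescope)
      also have "rho L I j (d j) = alt I" by (rule rho_top) (use sub in auto)
      also have "rho L I j 0 = flip j (alt I)" by (rule rho_0)
      also have "even (Y I (flip j (alt I)) + Y I (alt I)) =
        even (if j \<in> ch r then card {T\<in>flags L (C - I) (alt I) (Suc r). zero_in f r T} else 0)"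
        unfolding Y_def by (rule neg_count_flip[OF sub card j i0 r])
      finally show "even (\<Sum>i | i < d j \<and> (j, i) \<in> I. \<Sum>\<sigma>\<in>{L, -L}. Y I ((alt (I - {(j, i)}))((j, i) := \<sigma>))) =
        even (if j \<in> ch r then card {T\<in>flags L (C - I) (alt I) (Suc r). zero_in f r T} else 0)" .
    qed
    then show "even (\<Sum>I\<in>?E. \<Sum>i | i < d j \<and> (j, i) \<in> I. \<Sum>\<sigma>\<in>{L, -L}. Y I ((alt (I - {(j, i)}))((j, i) := \<sigma>))) =
      even (if j \<in> ch r then total r (s(j := Suc (s j))) else 0)"
      by (simp add: total_def)
  qed
  also have "(\<Sum>j\<in>J. if j \<in> ch r then total r (s(j := Suc (s j))) else 0) =
      (\<Sum>j\<in>J\<inter>ch r. total r (s(j := Suc (s j))))"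
    using J by (simp add: sum.inter_restrict)
  finally show ?thesis .
qed

lemma total_0: "(\<And>j. j \<in> J \<Longrightarrow> s j = d j) \<Longrightarrow> total 0 s = 1"
proof -
  assume s: "\<And>j. j \<in> J \<Longrightarrow> s j = d j"
  have "E s = {C}"
  proof (intro equalityI subsetI)
    fix I assume I: "I \<in> E s"
    have "{i. (j, i) \<in> I} = {..<d j}" if "j \<in> J" for j
      by (rule card_subset_eq) (use I that s in \<open>auto simp: E_def\<close>)
    then have "C \<subseteq> I" by auto
    then show "I \<in> {C}" using I by (auto simp: E_def)
  qed (use s in \<open>auto simp: E_def lessThan_def\<close>)
  moreover have "{T\<in>flags L {} w (Suc 0). zero_in f 0 T} = {{w}}" for w
  proof -
    have "face L {} w = {w}" by (auto simp: face_def)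
    moreover have "zero_in f 0 T" for T
      unfolding zero_in_def null_comb_def by (intro exI[of _ "\<lambda>_. 1"]) simp
    ultimately show ?thesis by (auto simp: flags_def fle_refl subset_singleton_iff)
  qed
  ultimately show ?thesis by (simp add: total_def)
qed

text \<open>The codimension in block \<open>j\<close> is the number of functions from
  \<open>r\<close> on that \<open>step\<close> assigns to it. In the recursion only
  \<open>j = step r\<close> survives: any other block of \<open>ch r\<close> receives no function up
  to \<open>r\<close>, so all its coordinates are fixed already.\<close>

lemma odd_total:
  assumes "r \<le> D"
  shows "odd (total r (\<lambda>j. card {t. r \<le> t \<and> t < D \<and> step t = j}))"
  using assms
proof (induction r)
  case 0
  then show ?case by (subst total_0) (auto simp: d_card)
next
  case (Suc r)
  let ?s = "\<lambda>r j. card {t. r \<le> t \<and> t < D \<and> step t = j}"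
  have fib: "(\<Sum>j\<in>J. ?s q j) = D - q" for q
  proof -
    have "(\<Sum>j\<in>J. \<Sum>t | t \<in> {q..<D} \<and> step t = j. 1) = (\<Sum>t\<in>{q..<D}. 1 :: nat)"
      by (rule sum.group) (use J step in auto)
    then show ?thesis by (simp add: conj_assoc)
  qed
  have "card C = (\<Sum>j\<in>J. d j)" using J by simp
  also have "\<dots> = (\<Sum>j\<in>J. ?s 0 j)" by (intro sum.cong) (auto simp: d_card)
  finally have "card C = D" using fib[of 0] by simp
  then have "(\<Sum>j\<in>J. ?s (Suc r) j) + Suc r = card C" using fib[of "Suc r"] Suc.prems by simp
  from total_step[OF this] have "even (total (Suc r) (?s (Suc r))) =
      even (\<Sum>j\<in>J\<inter>ch r. total r ((?s (Suc r))(j := Suc (?s (Suc r) j))))" using Suc.prems by simp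
  also have "(\<Sum>j\<in>J\<inter>ch r. total r ((?s (Suc r))(j := Suc (?s (Suc r) j)))) =
      (\<Sum>j\<in>{step r}. total r ((?s (Suc r))(j := Suc (?s (Suc r) j))))"
  proof (rule sum.mono_neutral_right)
    show "\<forall>j\<in>J \<inter> ch r - {step r}. total r ((?s (Suc r))(j := Suc (?s (Suc r) j))) = 0"
    proof
      fix j assume j: "j \<in> J \<inter> ch r - {step r}"
      have "step t \<noteq> j" if "t \<le> r" for t using ch[of r] Suc.prems j that by force
      then have "{t. Suc r \<le> t \<and> t < D \<and> step t = j} = {t. t < D \<and> step t = j}"
        using not_less_eq_eq by blast
      then have sj: "?s (Suc r) j = d j" using j by (simp add: d_card)
      have "E ((?s (Suc r))(j := Suc (?s (Suc r) j))) = {}"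
      proof (rule equals0I)
        fix I assume I: "I \<in> E ((?s (Suc r))(j := Suc (?s (Suc r) j)))"
        then have "card {i. (j, i) \<in> I} = Suc (d j)" using j sj by (auto simp: E_def)
        moreover have "card {i. (j, i) \<in> I} \<le> card {..<d j}"
          by (rule card_mono) (use I in \<open>auto simp: E_def\<close>)
        ultimately show False by simp
      qed
      then show "total r ((?s (Suc r))(j := Suc (?s (Suc r) j))) = 0" by (simp add: total_def)
    qed
    show "{step r} \<subseteq> J \<inter> ch r" using ch[of r] step[of r] Suc.prems by auto
  qed (use J in auto)
  also have "\<dots> = total r ((?s (Suc r))(step r := Suc (?s (Suc r) (step r))))" by simp
  also have "(?s (Suc r))(step r := Suc (?s (Suc r) (step r))) = ?s r"
  proof
    fix j
    have "{t. r \<le> t \<and> t < D \<and> step t = j} =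
      (if j = step r then insert r {t. Suc r \<le> t \<and> t < D \<and> step t = j} else {t. Suc r \<le> t \<and> t < D \<and> step t = j})"
      using Suc.prems by (auto simp: Suc_le_eq le_less)
    then show "((?s (Suc r))(step r := Suc (?s (Suc r) (step r)))) j = ?s r j" by auto
  qed
  finally show ?case using Suc by simp
qed

lemma exists_zero_flag: "\<exists>T. T \<in> flags L C (\<lambda>_. 0) (Suc D) \<and> zero_in f D T"
proof -
  have "total D (\<lambda>j. card {t. D \<le> t \<and> t < D \<and> step t = j}) \<noteq> 0" using odd_total[of D] by (intro notI) simp
  then obtain I where "I \<in> E (\<lambda>j. card {t. D \<le> t \<and> t < D \<and> step t = j})"
    "card {T\<in>flags L (C - I) (alt I) (Suc D). zero_in f D T} \<noteq> 0"
    unfolding total_def by (meson sum.neutral)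
  then have "I \<subseteq> C" "{T\<in>flags L (C - I) (alt I) (Suc D). zero_in f D T} \<noteq> {}" 
    by (auto simp: E_def simp del: Collect_empty_eq)
  then show ?thesis using alt_flags by blast
qed

end

section \<open>Equivariant perturbation and approximate zeros on the grid\<close>

definition neg_block :: "int \<Rightarrow> (nat \<Rightarrow> nat) \<Rightarrow> nat \<Rightarrow> (nat \<times> nat \<Rightarrow> int) \<Rightarrow> bool"
  where "neg_block L d j x \<longleftrightarrow> (\<exists>i<d j. x (j, i) = - L \<and> (\<forall>i'<i. \<bar>x (j, i')\<bar> \<noteq> L))"

text \<open>The first coordinate of modulus \<open>L\<close> decides the sign of a block, and the
  antipodal map of the block reverses it. Flipping all negative blocks thus selects an orbit
  representative for the gluing; a block without such a coordinate is left alone.\<close>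

definition positive_rep :: "int \<Rightarrow> (nat \<Rightarrow> nat) \<Rightarrow> (nat \<times> nat \<Rightarrow> int) \<Rightarrow> nat \<times> nat \<Rightarrow> int"
  where "positive_rep L d x = (\<lambda>c. if neg_block L d (fst c) x then - x c else x c)"

definition block_sign :: "int \<Rightarrow> (nat \<Rightarrow> nat) \<Rightarrow> nat set \<Rightarrow> (nat \<times> nat \<Rightarrow> int) \<Rightarrow> real"
  where "block_sign L d A x = (\<Prod>j\<in>A. if neg_block L d j x then -1 else 1)"

lemma neg_block_flip:
  assumes "L > 0" "i < d j" "\<bar>x (j, i)\<bar> = L"
  shows "neg_block L d j (flip j x) \<longleftrightarrow> \<not> neg_block L d j x"
proof -
  define m where "m = (LEAST i. \<bar>x (j, i)\<bar> = L)"
  have m: "\<bar>x (j, m)\<bar> = L" "m \<le> i" "\<And>i'. i' < m \<Longrightarrow> \<bar>x (j, i')\<bar> \<noteq> L"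
    using assms(3) unfolding m_def by (auto intro: LeastI Least_le dest: not_less_Least)
  have first: "i = m" if "\<bar>x (j, i)\<bar> = L" "\<forall>i'<i. \<bar>x (j, i')\<bar> \<noteq> L" for i
    using that m by (metis linorder_neqE_nat)
  have "neg_block L d j x \<longleftrightarrow> x (j, m) = - L"
    unfolding neg_block_def using first m assms by (smt (verit) le_less_trans)
  moreover have "neg_block L d j (flip j x) \<longleftrightarrow> x (j, m) = L"
    unfolding neg_block_def flip_def using first m assms by (smt (verit) le_less_trans fst_conv)
  ultimately show ?thesis using m assms(1) by linarith
qed

lemma neg_block_flip_other: "j' \<noteq> j \<Longrightarrow> neg_block L d j' (flip j x) \<longleftrightarrow> neg_block L d j' x"
  by (simp add: neg_block_def flip_def)

lemma positive_rep_flip: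
  assumes "L > 0" "i < d j" "\<bar>x (j, i)\<bar> = L"
  shows "positive_rep L d (flip j x) = positive_rep L d x"
proof
  fix c show "positive_rep L d (flip j x) c = positive_rep L d x c"
    using neg_block_flip[of L i d j x, OF assms] neg_block_flip_other[of "fst c" j L d x]
    by (cases "fst c = j") (auto simp: positive_rep_def flip_def)
qed

lemma block_sign_flip:
  assumes "L > 0" "i < d j" "\<bar>x (j, i)\<bar> = L" "finite A"
  shows "block_sign L d A (flip j x) = (if j \<in> A then -1 else 1) * block_sign L d A x"
proof -
  have *: "(\<Prod>j'\<in>B. if neg_block L d j' (flip j x) then -1 else 1 :: real) =
    (\<Prod>j'\<in>B. if neg_block L d j' x then -1 else 1)" if "j \<notin> B" for B
    using that neg_block_flip_other[of _ j L d x] by (intro prod.cong refl) metis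
  show ?thesis
  proof (cases "j \<in> A")
    case True
    then show ?thesis
      using assms(4) *[of "A - {j}"] neg_block_flip[of L i d j x, OF assms(1-3)]
      by (simp add: block_sign_def prod.remove[of A j])
  qed (simp add: block_sign_def *)
qed

lemma abs_block_sign: "\<bar>block_sign L d A x\<bar> = 1"
  unfolding block_sign_def abs_prod by (intro prod.neutral) auto

text \<open>Comparable grid points differ by at most 1 in each coordinate, while different signs of
  a block would put some coordinate at \<open>-L\<close> in one point and at \<open>L\<close> in the
  other.\<close>

lemma inj_on_positive_rep:
  assumes "L > 0" and T: "\<And>x y. x \<in> T \<Longrightarrow> y \<in> T \<Longrightarrow> fle x y \<or> fle y x"
  shows "inj_on (positive_rep L d) T"
proof (rule inj_onI)
  have no: False if "x \<in> T" "y \<in> T" "positive_rep L d x = positive_rep L d y"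
    and neg: "neg_block L d j x" "\<not> neg_block L d j y" for x y j
  proof -
    obtain i where i: "x (j, i) = - L" using neg(1) by (auto simp: neg_block_def)
    have "y (j, i) = L" using fun_cong[OF that(3), of "(j, i)"] neg i by (simp add: positive_rep_def)
    moreover have "\<bar>x (j, i) - y (j, i)\<bar> \<le> 1"
      using T[OF that(1,2)] unfolding fle_def by (metis abs_minus_commute abs_zero diff_self order_refl zero_le_one)
    ultimately show False using i assms(1) by simp
  qed
  fix x y assume xy: "x \<in> T" "y \<in> T" "positive_rep L d x = positive_rep L d y"
  have "neg_block L d j x = neg_block L d j y" for j
    using no[of x y j] no[of y x j] xy by auto
  then have "x c = y c" for c
    using fun_cong[OF xy(3), of c] by (simp add: positive_rep_def split: if_splits)
  then show "x = y" by blast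
qed

text \<open>The perturbation adds \<open>t r ^ idx\<close> on orbit representatives and extends it equivariantly; the
  vertices of a simplex lie in distinct orbits, so it is generic.\<close>

lemma equivariant_grid_almost_zero:
  fixes F :: "nat \<Rightarrow> (nat \<times> nat \<Rightarrow> int) \<Rightarrow> real"
  assumes J: "finite J" and L: "even L" "L > 0"
    and equi: "\<And>r x j. r < D \<Longrightarrow> x \<in> face L (SIGMA j:J. {..<d j}) (\<lambda>_. 0) \<Longrightarrow> j \<in> J \<Longrightarrow>
      \<exists>i<d j. \<bar>x (j, i)\<bar> = L \<Longrightarrow> F r (flip j x) = (if j \<in> ch r then - F r x else F r x)"
    and step: "\<And>t. t < D \<Longrightarrow> step t \<in> J" and d_card: "\<And>j. j \<in> J \<Longrightarrow> d j = card {t. t < D \<and> step t = j}"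
    and ch: "\<And>r. r < D \<Longrightarrow> ch r \<inter> step ` {..r} = {step r}"
    and \<epsilon>: "\<epsilon> > 0"
  obtains T where "T \<in> flags L (SIGMA j:J. {..<d j}) (\<lambda>_. 0) (Suc D)"
    "\<And>r. r < D \<Longrightarrow> (\<exists>x\<in>T. F r x < \<epsilon>) \<and> (\<exists>x\<in>T. F r x > - \<epsilon>)"
proof -
  let ?C = "SIGMA j:J. {..<d j}"
  define \<T> where "\<T> = {T. T \<subseteq> face L ?C (\<lambda>_. 0) \<and> (\<forall>x\<in>T. \<forall>y\<in>T. fle x y \<or> fle y x)}"
  have finface: "finite (face L ?C (\<lambda>_. 0))" using J by (intro finite_face) simp
  have "finite (positive_rep L d ` face L ?C (\<lambda>_. 0))" using finface by simp
  then obtain e :: "(nat \<times> nat \<Rightarrow> int) \<Rightarrow> nat" where e: "inj_on e (positive_rep L d ` face L ?C (\<lambda>_. 0))"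
    using finite_imp_inj_to_nat_seg by metis
  \<comment> \<open>The exponent depends only on the orbit, so the equivariance of the perturbation
    rests on \<open>sg\<close>; \<open>Suc\<close> keeps the exponent positive.\<close>
  define idx where "idx x = Suc (e (positive_rep L d x))" for x
  define sg where "sg r x = block_sign L d (J \<inter> ch r) x" for r x
  have abs_sg: "\<bar>sg r x\<bar> = 1" for r x by (simp add: sg_def abs_block_sign)
  \<comment> \<open>The bound 1 ensures that positive powers of \<open>t r\<close> do not exceed
    \<open>t r\<close>, hence stay below \<epsilon>.\<close>
  have "\<exists>t. (\<forall>r<D. 0 < t r \<and> t r < min \<epsilon> 1) \<and>
      (\<forall>T\<in>\<T>. generic (\<lambda>r v. F r v + sg r v * t r ^ idx v) D T)"
  proof (rule generic_perturbation)
    show "finite \<T>" by (rule finite_subset[of _ "Pow (face L ?C (\<lambda>_. 0))"]) (auto simp: \<T>_def finface)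
    show "finite T" if "T \<in> \<T>" for T using that finite_subset[OF _ finface] by (auto simp: \<T>_def)
    show "U \<in> \<T>" if "T \<in> \<T>" "U \<subseteq> T" for T U using that unfolding \<T>_def by blast
    show "inj_on idx T" if "T \<in> \<T>" for T
    proof -
      have "inj_on (positive_rep L d) T" using that L by (intro inj_on_positive_rep) (auto simp: \<T>_def)
      moreover have "inj_on e (positive_rep L d ` T)"
        by (rule inj_on_subset[OF e]) (use that in \<open>auto simp: \<T>_def\<close>)
      ultimately have "inj_on (e \<circ> positive_rep L d) T" by (rule comp_inj_on)
      then show ?thesis by (simp add: idx_def inj_on_def)
    qed
    show "sg r v \<noteq> 0" for r v using abs_sg[of r v] by auto
  qed (use \<epsilon> in \<open>auto simp: idx_def\<close>)
  then obtain t where t: "\<And>r. r < D \<Longrightarrow> 0 < t r" "\<And>r. r < D \<Longrightarrow> t r < \<epsilon>" "\<And>r. r < D \<Longrightarrow> t r < 1"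
    and gen: "\<And>T. T \<in> \<T> \<Longrightarrow> generic (\<lambda>r v. F r v + sg r v * t r ^ idx v) D T" by auto
  define f where "f = (\<lambda>r v. F r v + sg r v * t r ^ idx v)"
  interpret signed_cube J d L D ch step f
  proof
    show "generic f D T" if "T \<in> flags L ?C (\<lambda>_. 0) r" for T r
      unfolding f_def by (rule gen) (use that in \<open>auto simp: \<T>_def flags_def\<close>)
    fix r x j assume r: "r < D" and x: "x \<in> face L ?C (\<lambda>_. 0)" and j: "j \<in> J"
      and b: "\<exists>i<d j. \<bar>x (j, i)\<bar> = L"
    then obtain i where i: "i < d j" "\<bar>x (j, i)\<bar> = L" by blast
    have "idx (flip j x) = idx x" using positive_rep_flip[of L i d j x, OF L(2) i] by (simp add: idx_def)
    moreover have "sg r (flip j x) = (if j \<in> ch r then -1 else 1) * sg r x"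
      using block_sign_flip[of L i d j x "J \<inter> ch r", OF L(2) i] J j by (simp add: sg_def)
    ultimately show "f r (flip j x) = (if j \<in> ch r then - f r x else f r x)"
      using equi[OF r x j b] by (simp add: f_def)
  qed (use J L step d_card ch in auto)
  obtain T where T: "T \<in> flags L ?C (\<lambda>_. 0) (Suc D)" "zero_in f D T"
    using exists_zero_flag by blast
  then obtain b where b: "\<forall>v\<in>T. b v > 0" "null_comb f D T b" unfolding zero_in_def by blast
  have fin: "finite T" using T flags_finite[OF finite_C] by blast
  have ne: "T \<noteq> {}" using T by (auto simp: flags_def)
  have close: "\<bar>f r x - F r x\<bar> < \<epsilon>" if "r < D" for r x
  proof -
    have "\<bar>f r x - F r x\<bar> = t r ^ idx x" using abs_sg[of r x] t(1)[OF that] by (simp add: f_def abs_mult)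
    also have "\<dots> \<le> t r ^ 1" by (rule power_decreasing) (use t(1,3)[OF that] in \<open>auto simp: idx_def\<close>)
    finally show ?thesis using t(2)[OF that] by simp
  qed
  have "(\<exists>x\<in>T. F r x < \<epsilon>) \<and> (\<exists>x\<in>T. F r x > - \<epsilon>)" if r: "r < D" for r
  proof -
    \<comment> \<open>A positive combination of the vertex values vanishes, so they cannot all have
      the same strict sign.\<close>
    have 0: "(\<Sum>v\<in>T. b v * f r v) = 0" using b(2) r by (simp add: null_comb_def)
    have "\<exists>x\<in>T. f r x \<le> 0"
    proof (rule ccontr)
      assume "\<not> (\<exists>x\<in>T. f r x \<le> 0)"
      then have "(\<Sum>v\<in>T. b v * f r v) > 0" using b fin ne by (intro sum_pos) auto
      then show False using 0 by simp
    qed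
    moreover have "\<exists>x\<in>T. f r x \<ge> 0"
    proof (rule ccontr)
      assume "\<not> (\<exists>x\<in>T. f r x \<ge> 0)"
      then have "(\<Sum>v\<in>T. b v * (- f r v)) > 0"
        using b(1) fin ne by (intro sum_pos mult_pos_pos) (auto simp: not_le)
      then show False using 0 by (simp add: sum_negf)
    qed
    ultimately show ?thesis using close[OF r] by (smt (verit))
  qed
  then show thesis using T(1) that by blast
qed

section \<open>From grids to continuous functions on a product of cubes\<close>

definition unit_cube :: "'c set \<Rightarrow> ('c \<Rightarrow> real) set"
  where "unit_cube C = {y. \<forall>c. if c \<in> C then \<bar>y c\<bar> \<le> 1 else y c = 0}"

lemma unit_cubeI:
  "(\<And>c. c \<in> C \<Longrightarrow> \<bar>y c\<bar> \<le> 1) \<Longrightarrow> (\<And>c. c \<notin> C \<Longrightarrow> y c = 0) \<Longrightarrow> y \<in> unit_cube C"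
  by (simp add: unit_cube_def)

lemma compact_unit_cube: "compact (unit_cube C)"
proof -
  have "compactin (product_topology (\<lambda>_. euclideanreal) UNIV) (PiE UNIV (\<lambda>c. if c \<in> C then {-1..1} else {0}))"
    by (auto simp: compactin_PiE)
  moreover have "PiE UNIV (\<lambda>c. if c \<in> C then {-1..1} else {0}) = unit_cube C"
    by (auto simp: unit_cube_def PiE_iff abs_le_iff split: if_splits)
  ultimately show ?thesis by (simp add: euclidean_product_topology)
qed

text \<open>Ever finer grids give simplices on which each function takes almost nonpositive and
  almost nonnegative values. By compactness a subsequence of them shrinks to a point, where
  continuity forces all functions to vanish.\<close>

theorem equivariant_cube_zero:
  fixes h :: "nat \<Rightarrow> (nat \<times> nat \<Rightarrow> real) \<Rightarrow> real"
  assumes J: "finite J"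
    and cont: "\<And>r. r < D \<Longrightarrow> continuous_on (unit_cube (SIGMA j:J. {..<d j})) (h r)"
    and equi: "\<And>r y j. r < D \<Longrightarrow> y \<in> unit_cube (SIGMA j:J. {..<d j}) \<Longrightarrow> j \<in> J \<Longrightarrow>
      \<exists>i<d j. \<bar>y (j, i)\<bar> = 1 \<Longrightarrow> h r (flip j y) = (if j \<in> ch r then - h r y else h r y)"
    and step: "\<And>t. t < D \<Longrightarrow> step t \<in> J" and d_card: "\<And>j. j \<in> J \<Longrightarrow> d j = card {t. t < D \<and> step t = j}"
    and ch: "\<And>r. r < D \<Longrightarrow> ch r \<inter> step ` {..r} = {step r}"
  shows "\<exists>y\<in>unit_cube (SIGMA j:J. {..<d j}). \<forall>r<D. h r y = 0"
proof -
  let ?C = "SIGMA j:J. {..<d j}"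
  \<comment> \<open>Even, as the grid requires, and with \<open>1 / L m\<close> at most
    \<open>\<epsilon> m\<close>, so that mesh and tolerance tend to 0 together.\<close>
  define L :: "nat \<Rightarrow> int" where "L m = 2 * (int m + 1)" for m
  define \<epsilon> :: "nat \<Rightarrow> real" where "\<epsilon> m = 1 / real (Suc m)" for m
  define sc where "sc m x = (\<lambda>c. real_of_int (x c) / real_of_int (L m))" for m and x :: "nat \<times> nat \<Rightarrow> int"
  have L: "even (L m)" "L m > 0" for m by (auto simp: L_def)
  have sc: "sc m x \<in> unit_cube ?C" if x: "x \<in> face (L m) ?C (\<lambda>_. 0)" for m x
  proof -
    have "\<bar>sc m x c\<bar> \<le> 1" if c: "c \<in> ?C" for c
    proof -
      have "real_of_int \<bar>x c\<bar> \<le> real_of_int (L m)" using face_bound[OF x c] by linarith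
      then show ?thesis using L(2)[of m] by (simp only: sc_def abs_divide of_int_abs) simp
    qed
    moreover have "sc m x c = 0" if c: "c \<notin> ?C" for c
      using face_fixed[OF x c] by (simp only: sc_def of_int_0 div_0)
    ultimately show ?thesis by (rule unit_cubeI)
  qed
  have "\<exists>T. T \<in> flags (L m) ?C (\<lambda>_. 0) (Suc D) \<and>
      (\<forall>r<D. (\<exists>x\<in>T. h r (sc m x) < \<epsilon> m) \<and> (\<exists>x\<in>T. h r (sc m x) > - \<epsilon> m))" for m
  proof (rule equivariant_grid_almost_zero[where F = "\<lambda>r x. h r (sc m x)" and L = "L m" and \<epsilon> = "\<epsilon> m"
      and J = J and d = d and D = D and ch = ch and step = step])
    fix r x j assume r: "r < D" and x: "x \<in> face (L m) ?C (\<lambda>_. 0)" and j: "j \<in> J"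
      and "\<exists>i<d j. \<bar>x (j, i)\<bar> = L m"
    then obtain i where i: "i < d j" "\<bar>x (j, i)\<bar> = L m" by blast
    have "\<bar>sc m x (j, i)\<bar> = 1" using i L(2)[of m] by (simp add: sc_def flip: of_int_abs)
    then have "\<exists>i<d j. \<bar>sc m x (j, i)\<bar> = 1" using i by blast
    moreover have "sc m (flip j x) = flip j (sc m x)" by (auto simp: sc_def flip_def)
    ultimately show "h r (sc m (flip j x)) = (if j \<in> ch r then - h r (sc m x) else h r (sc m x))"
      using equi[OF r sc[OF x] j] by simp
  next
    fix T assume "T \<in> flags (L m) ?C (\<lambda>_. 0) (Suc D)"
      "\<And>r. r < D \<Longrightarrow> (\<exists>x\<in>T. h r (sc m x) < \<epsilon> m) \<and> (\<exists>x\<in>T. h r (sc m x) > - \<epsilon> m)"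
    then show ?thesis by blast
  qed (use J L step d_card ch in \<open>auto simp: \<epsilon>_def\<close>)
  then obtain T where T: "\<And>m. T m \<in> flags (L m) ?C (\<lambda>_. 0) (Suc D)"
    and T': "\<And>m r. r < D \<Longrightarrow> (\<exists>x\<in>T m. h r (sc m x) < \<epsilon> m)"
      "\<And>m r. r < D \<Longrightarrow> (\<exists>x\<in>T m. h r (sc m x) > - \<epsilon> m)"
    by metis
  have "\<exists>x. x \<in> T m" for m
  proof -
    have "card (T m) = Suc D" using T[of m] by (simp add: flags_def)
    then show ?thesis by (metis card.empty ex_in_conv nat.distinct(1))
  qed
  then obtain p where p: "\<And>m. p m \<in> T m" by metis
  have Tf: "x \<in> face (L m) ?C (\<lambda>_. 0)" if "x \<in> T m" for m x using T[of m] that by (auto simp: flags_def)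
  have "\<forall>m. sc m (p m) \<in> unit_cube ?C" using sc Tf p by blast
  then obtain y \<sigma> where y: "y \<in> unit_cube ?C" "strict_mono (\<sigma> :: nat \<Rightarrow> nat)"
    "((\<lambda>m. sc m (p m)) \<circ> \<sigma>) \<longlonglongrightarrow> y"
    by (rule seq_compactE[OF compact_imp_seq_compact[OF compact_unit_cube]])
  have \<epsilon>0: "(\<lambda>m. \<epsilon> (\<sigma> m)) \<longlonglongrightarrow> 0"
    using LIMSEQ_subseq_LIMSEQ[OF LIMSEQ_Suc[OF lim_1_over_n] y(2)] by (simp add: \<epsilon>_def comp_def)
  have coord: "(f \<longlongrightarrow> l) F \<longleftrightarrow> (\<forall>c. ((\<lambda>m. f m c) \<longlongrightarrow> (l c)) F)"
    for f :: "nat \<Rightarrow> nat \<times> nat \<Rightarrow> real" and l F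
    using limitin_componentwise[of "\<lambda>_. euclideanreal" UNIV f l F]
    by (simp add: euclidean_product_topology)
  \<comment> \<open>Vertices of one simplex differ by at most \<open>1 / L\<close> in each
    coordinate after scaling, so every choice of vertices converges to the limit found for
    \<open>p\<close>.\<close>
  have lim: "(\<lambda>m. sc (\<sigma> m) (a (\<sigma> m))) \<longlonglongrightarrow> y" if a: "\<And>m. a m \<in> T m" for a
    unfolding coord
  proof
    fix c
    have pc: "(\<lambda>m. sc (\<sigma> m) (p (\<sigma> m)) c) \<longlonglongrightarrow> y c" using y(3) unfolding coord comp_def by blast
    have "(\<lambda>m. sc (\<sigma> m) (a (\<sigma> m)) c - sc (\<sigma> m) (p (\<sigma> m)) c) \<longlonglongrightarrow> 0"
    proof (rule Lim_null_comparison[OF _ \<epsilon>0], rule always_eventually, rule allI)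
      fix m
      let ?m = "\<sigma> m"
      have "fle (a ?m) (p ?m) \<or> fle (p ?m) (a ?m)" using T[of ?m] a p by (auto simp: flags_def)
      then have "\<bar>a ?m c - p ?m c\<bar> \<le> 1"
        unfolding fle_def by (metis abs_minus_commute abs_zero diff_self order_refl zero_le_one)
      then have "\<bar>real_of_int (a ?m c) - real_of_int (p ?m c)\<bar> \<le> 1" by linarith
      then have "\<bar>sc ?m (a ?m) c - sc ?m (p ?m) c\<bar> \<le> 1 / real_of_int (L ?m)"
        using L(2)[of ?m] by (simp add: sc_def divide_right_mono flip: diff_divide_distrib)
      also have "\<dots> \<le> \<epsilon> ?m" by (simp add: \<epsilon>_def L_def field_simps)
      finally show "norm (sc ?m (a ?m) c - sc ?m (p ?m) c) \<le> \<epsilon> ?m" by simp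
    qed
    from tendsto_add[OF this pc] show "(\<lambda>m. sc (\<sigma> m) (a (\<sigma> m)) c) \<longlonglongrightarrow> y c" by simp
  qed
  have hlim: "(\<lambda>m. h r (sc (\<sigma> m) (a (\<sigma> m)))) \<longlonglongrightarrow> h r y" if "r < D" "\<And>m. a m \<in> T m" for a r
    by (rule continuous_on_tendsto_compose[OF cont[OF that(1)] lim[OF that(2)] y(1)])
       (intro always_eventually allI sc Tf that(2))
  have "h r y = 0" if r: "r < D" for r
  proof -
    obtain a where a: "\<And>m. a m \<in> T m" "\<And>m. h r (sc m (a m)) < \<epsilon> m" using T'(1)[OF r] by metis
    obtain b where b: "\<And>m. b m \<in> T m" "\<And>m. h r (sc m (b m)) > - \<epsilon> m" using T'(2)[OF r] by metis
    have "h r y \<le> 0"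
      by (rule LIMSEQ_le[OF hlim[OF r a(1)] \<epsilon>0]) (use a(2) in \<open>auto intro: less_imp_le\<close>)
    moreover have "- 0 \<le> h r y"
      by (rule LIMSEQ_le[OF tendsto_minus[OF \<epsilon>0] hlim[OF r b(1)]]) (use b(2) in \<open>auto intro: less_imp_le\<close>)
    ultimately show ?thesis by simp
  qed
  then show ?thesis using y(1) by blast
qed

section \<open>Orthonormal frames\<close>

definition bump :: "nat \<Rightarrow> nat \<Rightarrow> (nat \<times> nat \<Rightarrow> real) \<Rightarrow> real"
  where "bump a j y = (\<Prod>i<a. 1 - (y (j, i))\<^sup>2)"

definition lift :: "nat \<Rightarrow> nat \<Rightarrow> (nat \<times> nat \<Rightarrow> real) \<Rightarrow> nat \<Rightarrow> real"
  where "lift a j y = (\<lambda>i. if i < a then y (j, i) else if i = a then bump a j y else 0)"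

text \<open>Radial projection of the graph of \<open>bump\<close> sends the cube
  \<open>[-1, 1]^a\<close> to the upper hemisphere of the \<open>a\<close>-sphere. On the boundary
  of the cube \<open>bump\<close> vanishes, so the antipodal map there becomes that of the
  equator.\<close>

definition chart :: "nat \<Rightarrow> nat \<Rightarrow> (nat \<times> nat \<Rightarrow> real) \<Rightarrow> nat \<Rightarrow> real"
  where "chart a j y = (\<lambda>i. lift a j y i / sqrt (\<Sum>i\<le>a. (lift a j y i)\<^sup>2))"

text \<open>If the first \<open>a\<close> coordinates vanish, the remaining one is 1.\<close>

lemma lift_norm_pos: "(\<Sum>i\<le>a. (lift a j y i)\<^sup>2) > 0"
proof (rule ccontr)
  assume "\<not> ?thesis"
  then have "(\<Sum>i\<le>a. (lift a j y i)\<^sup>2) = 0" using sum_nonneg[of "{..a}" "\<lambda>i. (lift a j y i)\<^sup>2"] by force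
  then have 0: "lift a j y i = 0" if "i \<le> a" for i using that by (simp add: sum_nonneg_eq_0_iff)
  have "y (j, i) = 0" if "i < a" for i using 0[of i] that by (simp add: lift_def)
  then have "lift a j y a = 1" by (simp add: lift_def bump_def)
  then show False using 0[of a] by simp
qed

lemma chart_norm: "(\<Sum>i\<le>a. (chart a j y i)\<^sup>2) = 1"
  using lift_norm_pos[of a j y] by (simp add: chart_def power_divide flip: sum_divide_distrib)

lemma chart_zero: "i > a \<Longrightarrow> chart a j y i = 0"
  by (simp add: chart_def lift_def)

lemma chart_flip:
  assumes "i < a" "\<bar>y (j, i)\<bar> = 1"
  shows "chart a j (flip j y) = (\<lambda>i. - chart a j y i)"
proof -
  have "(y (j, i))\<^sup>2 = 1" using assms(2) by (metis abs_square_eq_1 power2_abs one_power2)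
  then have 0: "bump a j y = 0" using assms(1) by (auto simp: bump_def intro!: prod_zero)
  have "bump a j (flip j y) = bump a j y" by (simp add: bump_def flip_def)
  with 0 have "lift a j (flip j y) = (\<lambda>i. - lift a j y i)"
    by (auto simp: lift_def flip_def)
  then show ?thesis by (simp add: chart_def)
qed

lemma chart_flip_other: "j' \<noteq> j \<Longrightarrow> chart a j' (flip j y) = chart a j' y"
proof -
  assume "j' \<noteq> j"
  then have "bump a j' (flip j y) = bump a j' y" by (simp add: bump_def flip_def)
  then have "lift a j' (flip j y) = lift a j' y" using \<open>j' \<noteq> j\<close> by (auto simp: lift_def flip_def)
  then show ?thesis by (simp add: chart_def)
qed

lemma continuous_on_eval: "continuous_on S (\<lambda>y :: 'a \<Rightarrow> real. y c)"
  by (rule continuous_on_subset[OF continuous_on_product_coordinates]) simp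

lemma continuous_on_lift: "continuous_on S (\<lambda>y. lift a j y i)"
  unfolding lift_def bump_def
  by (cases "i < a"; cases "i = a") (auto intro!: continuous_intros continuous_on_eval)

lemma continuous_on_chart: "continuous_on S (\<lambda>y. chart a j y i)"
proof -
  have "sqrt (\<Sum>i\<le>a. (lift a j y i)\<^sup>2) \<noteq> 0" for y using lift_norm_pos[of a j y] by simp
  then show ?thesis unfolding chart_def by (intro continuous_intros continuous_on_lift) auto
qed

section \<open>Frames inside the space of all tuples\<close>

definition tuple_space :: "nat \<Rightarrow> (nat \<Rightarrow> nat \<Rightarrow> real) topology"
  where "tuple_space k = product_topology (\<lambda>_. powertop_real UNIV) {1..k}"

lemma topspace_tuple_space: "topspace (tuple_space k) = extensional {1..k}"
  by (auto simp: tuple_space_def PiE_def)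

lemma continuous_map_tuple_coord:
  assumes "j \<in> {1..k}"
  shows "continuous_map (tuple_space k) euclideanreal (\<lambda>x. x j i)"
proof -
  have "continuous_map (tuple_space k) (powertop_real UNIV) (\<lambda>x. x j)"
    unfolding tuple_space_def using assms by (rule continuous_map_product_projection)
  moreover have "continuous_map (powertop_real UNIV) euclideanreal (\<lambda>v. v i)"
    by (rule continuous_map_product_projection) simp
  ultimately show ?thesis using continuous_map_compose by (force simp: o_def)
qed

lemma continuous_map_tuple_inner:
  assumes "i \<in> {1..k}" "j \<in> {1..k}"
  shows "continuous_map (tuple_space k) euclideanreal (\<lambda>x. euclidean_inner n (x i) (x j))"
  unfolding euclidean_inner_def
  by (intro continuous_map_sum continuous_map_real_mult continuous_map_tuple_coord assms) auto

lemma nsphere_eq_subtopology: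
  "nsphere a = subtopology (powertop_real UNIV) {v. (\<Sum>i\<le>a. (v i)\<^sup>2) = 1 \<and> (\<forall>i\<ge>Suc a. v i = 0)}"
  unfolding nsphere Euclidean_space_def subtopology_subtopology by (rule arg_cong[of _ _ "subtopology _"]) auto

lemma flag_frames_eq_subtopology:
  "flag_frames n k = subtopology (tuple_space k) (topspace (flag_frames n k))"
proof -
  let ?S = "\<lambda>j. {v. (\<Sum>i\<le>n - k + j - 1. (v i)\<^sup>2) = 1 \<and> (\<forall>i\<ge>Suc (n - k + j - 1). v i = 0)}"
  let ?O = "{x :: nat \<Rightarrow> nat \<Rightarrow> real. \<forall>i\<in>{1..k}. \<forall>j\<in>{1..k}. i \<noteq> j \<longrightarrow> euclidean_inner n (x i) (x j) = 0}"
  have eq: "flag_frames n k = subtopology (tuple_space k) (PiE {1..k} ?S \<inter> ?O)"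
    unfolding flag_frames_def tuple_space_def nsphere_eq_subtopology
    by (simp only: subtopology_subtopology flip: subtopology_product_topology)
  have "topspace (flag_frames n k) = topspace (tuple_space k) \<inter> (PiE {1..k} ?S \<inter> ?O)"
    unfolding eq by (rule topspace_subtopology)
  then show ?thesis by (simp only: subtopology_restrict eq)
qed

lemma closedin_zero_set:
  assumes "\<And>i. i \<in> I \<Longrightarrow> continuous_map X euclideanreal (\<phi> i)"
  shows "closedin X {x \<in> topspace X. \<forall>i\<in>I. \<phi> i x = 0}"
proof -
  have "{x \<in> topspace X. \<forall>i\<in>I. \<phi> i x = 0} =
    topspace X \<inter> \<Inter> ((\<lambda>i. {x \<in> topspace X. \<phi> i x \<in> {0}}) ` I)" by auto
  moreover have "closedin X {x \<in> topspace X. \<phi> i x \<in> {0}}" if "i \<in> I" for i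
    by (rule closedin_continuous_map_preimage[OF assms[OF that]]) simp
  ultimately show ?thesis by (cases "I = {}") (auto intro!: closedin_Inter closedin_Int)
qed

text \<open>The frames are cut out by zero sets of continuous functions inside a product of
  intervals \<open>[-1, 1]\<close>, since the entries of unit vectors are bounded by 1.\<close>

lemma compactin_flag_frames:
  assumes "1 \<le> k" "k \<le> n"
  shows "compactin (tuple_space k) (topspace (flag_frames n k))"
proof (rule closed_compactin)
  let ?M = "topspace (flag_frames n k)"
  let ?B = "PiE {1..k} (\<lambda>_. PiE UNIV (\<lambda>_. {-1..1 :: real}))"
  show "compactin (tuple_space k) ?B"
    unfolding tuple_space_def by (auto simp: compactin_PiE)
  show "?M \<subseteq> ?B"
  proof
    fix x assume x: "x \<in> ?M"
    have "\<bar>x j i\<bar> \<le> 1" if j: "j \<in> {1..k}" for j i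
    proof (cases "i < n")
      case True
      have "x j i * x j i \<le> (\<Sum>i<n. x j i * x j i)" by (rule member_le_sum) (use True in auto)
      also have "\<dots> = 1"
        using x j unfolding topspace_flag_frames[OF assms] euclidean_inner_def by blast
      finally show ?thesis by (simp add: abs_square_le_1 power2_eq_square flip: power2_eq_square)
    next
      case False
      then have "x j i = 0" using x j assms unfolding topspace_flag_frames[OF assms] by auto
      then show ?thesis by simp
    qed
    moreover have "x \<in> extensional {1..k}" using x unfolding topspace_flag_frames[OF assms] by blast
    ultimately show "x \<in> ?B" by (auto simp: PiE_iff abs_le_iff minus_le_iff)
  qed
  let ?Y = "tuple_space k" and ?P = "{p \<in> {1..k} \<times> {1..k}. fst p \<noteq> snd p}"
  have M: "?M = {x \<in> topspace ?Y. \<forall>p\<in>(SIGMA j:{1..k}. {n - k + j..}). x (fst p) (snd p) = 0} \<inter>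
    {x \<in> topspace ?Y. \<forall>j\<in>{1..k}. euclidean_inner n (x j) (x j) - 1 = 0} \<inter>
    {x \<in> topspace ?Y. \<forall>p\<in>?P. euclidean_inner n (x (fst p)) (x (snd p)) = 0}"
    unfolding topspace_flag_frames[OF assms] topspace_tuple_space by auto
  show "closedin ?Y ?M" unfolding M
    by (intro closedin_Int closedin_zero_set continuous_map_tuple_coord continuous_map_tuple_inner
        continuous_map_diff) auto
qed

lemma finite_Z2_power: "finite (carrier (Z2_power k))"
  by (auto simp: Z2_power_def carrier_integer_mod_group intro!: finite_PiE)

lemma sign_square:
  assumes "g \<in> carrier (Z2_power k)" "j \<in> {1..k}"
  shows "(-1::real) powi g j * (-1) powi g j = 1"
  using carrier_Z2_power_cases[OF assms] by auto

lemma frame_act_mult: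
  assumes "g \<in> carrier (Z2_power k)" "h \<in> carrier (Z2_power k)"
  shows "frame_act k (g \<otimes>\<^bsub>Z2_power k\<^esub> h) x = frame_act k g (frame_act k h x)"
  using Z2_sign_mult[OF assms] by (auto simp: frame_act_def fun_eq_iff)

lemma continuous_map_frame_act: "continuous_map (tuple_space k) (tuple_space k) (frame_act k g)"
  unfolding tuple_space_def
proof (subst continuous_map_componentwise, intro conjI ballI)
  show "frame_act k g ` topspace (product_topology (\<lambda>_. powertop_real UNIV) {1..k}) \<subseteq> extensional {1..k}"
    by (auto simp: frame_act_def)
  fix j assume j: "j \<in> {1..k}"
  show "continuous_map (product_topology (\<lambda>_. powertop_real UNIV) {1..k}) (powertop_real UNIV) (\<lambda>x. frame_act k g x j)"
    unfolding tuple_space_def[symmetric] continuous_map_componentwise_UNIV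
    using j by (auto simp: frame_act_def intro!: continuous_map_real_mult continuous_map_tuple_coord)
qed

text \<open>Tietze extension followed by averaging over the group.\<close>

lemma equivariant_extension:
  assumes nk: "1 \<le> k" "k \<le> n"
    and cont: "continuous_map (flag_frames n k) euclideanreal f"
    and equi: "\<And>g x. g \<in> carrier (Z2_power k) \<Longrightarrow> x \<in> topspace (flag_frames n k) \<Longrightarrow>
      f (frame_act k g x) = (-1) powi g j * f x"
    and j: "j \<in> {1..k}"
  obtains F where "continuous_map (tuple_space k) euclideanreal F"
    "\<And>x p. p \<in> {1..k} \<Longrightarrow> F (frame_act k (Z2_gen k p) x) = (if p = j then - F x else F x)"
    "\<And>x. x \<in> topspace (flag_frames n k) \<Longrightarrow> F x = 0 \<Longrightarrow> f x = 0"
proof -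
  let ?M = "topspace (flag_frames n k)" and ?G = "carrier (Z2_power k)"
  interpret group "Z2_power k" by (rule group_Z2_power)
  \<comment> \<open>With countably many factors the ambient space is metrizable, hence completely
    regular, and functions extend from compact subsets.\<close>
  have "countable {i \<in> {1..k}. \<not> (\<exists>a. topspace (euclidean :: (nat \<Rightarrow> real) topology) \<subseteq> {a})}"
    by (rule countable_finite) simp
  then have "metrizable_space (tuple_space k)"
    unfolding tuple_space_def euclidean_product_topology metrizable_space_product_topology
    by (simp add: metrizable_space_euclidean)
  then have "completely_regular_space (tuple_space k)" by (rule metrizable_imp_completely_regular_space)
  moreover have "continuous_map (subtopology (tuple_space k) ?M) euclideanreal f"
    using cont flag_frames_eq_subtopology by simp
  ultimately obtain g where g: "continuous_map (tuple_space k) euclideanreal g" "\<And>x. x \<in> ?M \<Longrightarrow> g x = f x"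
    using Tietze_extension_completely_regular[OF _ compactin_flag_frames[OF nk], of UNIV f] by auto
  \<comment> \<open>The average is twisted by the character of the \<open>j\<close>-th line and not
    normalised: on frames it is the group order times \<open>f\<close>, with the same zeros.\<close>
  define F where "F x = (\<Sum>a\<in>?G. (-1) powi a j * g (frame_act k a x))" for x
  show thesis
  proof (rule that)
    show "continuous_map (tuple_space k) euclideanreal F"
      unfolding F_def
      by (intro continuous_map_sum continuous_map_real_mult finite_Z2_power continuous_map_const[THEN iffD2]
          continuous_map_compose[OF continuous_map_frame_act g(1), unfolded o_def]) auto
    fix x p assume p: "p \<in> {1..k}"
    let ?e = "Z2_gen k p"
    have e: "?e \<in> ?G" by (rule Z2_gen_in_carrier)
    have sg: "(-1::real) powi ?e j = (if p = j then -1 else 1)" using j by (auto simp: Z2_gen_def)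
    have "F x = (\<Sum>a\<in>?G. (-1) powi (a \<otimes>\<^bsub>Z2_power k\<^esub> ?e) j * g (frame_act k (a \<otimes>\<^bsub>Z2_power k\<^esub> ?e) x))"
      unfolding F_def
    proof (rule sum.reindex_bij_betw[symmetric])
      show "bij_betw (\<lambda>a. a \<otimes>\<^bsub>Z2_power k\<^esub> ?e) ?G ?G"
        using e by (intro bij_betw_byWitness[where f' = "\<lambda>a. a \<otimes>\<^bsub>Z2_power k\<^esub> inv\<^bsub>Z2_power k\<^esub> ?e"])
          (auto simp: m_assoc)
    qed
    also have "\<dots> = (\<Sum>a\<in>?G. (-1) powi ?e j * ((-1) powi a j * g (frame_act k a (frame_act k ?e x))))"
      by (intro sum.cong refl) (simp add: Z2_sign_mult[OF _ e j] frame_act_mult[OF _ e] mult_ac)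
    also have "\<dots> = (-1) powi ?e j * F (frame_act k ?e x)" by (simp add: F_def sum_distrib_left)
    finally show "F (frame_act k ?e x) = (if p = j then - F x else F x)" by (simp add: sg)
  next
    fix x assume x: "x \<in> ?M" and "F x = 0"
    have "frame_act k a x \<in> ?M" if "a \<in> ?G" for a
      using group_action.element_image[OF group_action_frames[OF nk] that x, of "frame_act k a x"] x by simp
    then have "F x = (\<Sum>a\<in>?G. (-1) powi a j * ((-1) powi a j * f x))"
      unfolding F_def by (intro sum.cong refl) (simp add: g(2) equi x)
    also have "\<dots> = (\<Sum>a\<in>?G. f x)"
      by (intro sum.cong refl) (simp add: sign_square j flip: mult.assoc)
    also have "\<dots> = real (card ?G) * f x" by simp
    finally have "real (card ?G) * f x = 0" using \<open>F x = 0\<close> by simp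
    moreover have "card ?G \<noteq> 0" using finite_Z2_power one_closed by (auto simp: card_eq_0_iff)
    ultimately show "f x = 0" by simp
  qed
qed

text \<open>Entry \<open>(p, q, l)\<close> stands for the function \<open>\<langle>x_p, x_q\<rangle>\<close> if \<open>p < q\<close> and for the \<open>l\<close>-th
  component in \<open>V_p\<close> if \<open>p = q\<close>. In this order the mod 2 count of zeros follows a single monomial.\<close>

lemma test_function_enumeration:
  fixes k m :: nat
  shows "\<exists>xs :: (nat \<times> nat \<times> nat) list.
    (\<forall>p q l. (p, q, l) \<in> set xs \<longleftrightarrow> 1 \<le> p \<and> q \<le> k \<and> (p < q \<and> l = 0 \<or> p = q \<and> 1 \<le> l \<and> l \<le> m)) \<and>
    (\<forall>j\<in>{1..k}. card {t. t < length xs \<and> fst (snd (xs ! t)) = j} = m + j - 1) \<and>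
    (\<forall>r<length xs. {fst (xs ! r), fst (snd (xs ! r))} \<inter> (\<lambda>t. fst (snd (xs ! t))) ` {..r} = {fst (snd (xs ! r))})"
proof -
  define I :: "(nat \<times> nat \<times> nat) set" where
    "I = {(p, q, l). 1 \<le> p \<and> q \<le> k \<and> (p < q \<and> l = 0 \<or> p = q \<and> 1 \<le> l \<and> l \<le> m)}"
  \<comment> \<open>Inner products come first, by decreasing \<open>p\<close>, and components of the
    map last. When \<open>(p, q, 0)\<close> with \<open>p < q\<close> is reached, all second indices
    so far exceed \<open>p\<close>, so among the blocks \<open>p\<close> and \<open>q\<close> only
    \<open>q\<close> has served as a step.\<close>
  define key :: "nat \<times> nat \<times> nat \<Rightarrow> nat" where
    "key = (\<lambda>(p, q, l). if p < q then k - p else k)"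
  have "finite I" by (rule finite_subset[of _ "{..k} \<times> {..k} \<times> {..m}"]) (auto simp: I_def)
  then obtain ys where ys: "set ys = I" "distinct ys" using finite_distinct_list by blast
  define xs where "xs = sort_key key ys"
  have xs: "set xs = I" "distinct xs" "sorted (map key xs)" using ys by (auto simp: xs_def)
  show ?thesis
  proof (intro exI[of _ xs] conjI allI ballI impI)
    show "(p, q, l) \<in> set xs \<longleftrightarrow> 1 \<le> p \<and> q \<le> k \<and> (p < q \<and> l = 0 \<or> p = q \<and> 1 \<le> l \<and> l \<le> m)" for p q l
      unfolding xs(1) I_def by simp
    show "card {t. t < length xs \<and> fst (snd (xs ! t)) = j} = m + j - 1" if j: "j \<in> {1..k}" for j
    proof -
      have "bij_betw ((!) xs) {t. t < length xs \<and> fst (snd (xs ! t)) = j} {it\<in>I. fst (snd it) = j}"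
        using xs by (auto simp: bij_betw_def inj_on_def nth_eq_iff_index_eq set_conv_nth)
      then have "card {t. t < length xs \<and> fst (snd (xs ! t)) = j} = card {it\<in>I. fst (snd it) = j}"
        by (rule bij_betw_same_card)
      \<comment> \<open>The \<open>j - 1\<close> inner products with larger index \<open>j\<close>
        and the \<open>m\<close> components in the \<open>j\<close>-th line: for
        \<open>m = n - k\<close> their number is the dimension of the \<open>j\<close>-th
        sphere.\<close>
      also have "{it\<in>I. fst (snd it) = j} = (\<lambda>p. (p, j, 0)) ` {1..<j} \<union> (\<lambda>l. (j, j, l)) ` {1..m}"
        using j by (auto simp: I_def)
      also have "card \<dots> = card ((\<lambda>p. (p, j, 0 :: nat)) ` {1..<j}) + card ((\<lambda>l. (j, j, l)) ` {1..m})"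
        by (rule card_Un_disjoint) auto
      also have "\<dots> = m + j - 1" using j by (simp add: card_image inj_on_def)
      finally show ?thesis .
    qed
    show "{fst (xs ! r), fst (snd (xs ! r))} \<inter> (\<lambda>t. fst (snd (xs ! t))) ` {..r} = {fst (snd (xs ! r))}"
      if r: "r < length xs" for r
    proof -
      obtain p q l where pql: "xs ! r = (p, q, l)" by (cases "xs ! r") auto
      have I: "(p, q, l) \<in> I" using r xs(1) pql by (metis nth_mem)
      have "fst (snd (xs ! t)) \<noteq> p" if t: "t \<le> r" and "p < q" for t
      proof -
        obtain p' q' l' where t': "xs ! t = (p', q', l')" by (cases "xs ! t") auto
        have I': "(p', q', l') \<in> I" using r t xs(1) t' by (metis le_less_trans nth_mem)
        have "key (xs ! t) \<le> key (xs ! r)"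
          using sorted_nth_mono[OF xs(3), of t r] r t by simp
        then have "p < q'" using I I' \<open>p < q\<close> by (auto simp: key_def t' pql I_def split: if_splits)
        then show ?thesis by (simp add: t')
      qed
      then have "fst (snd (xs ! t)) \<noteq> p" if "t \<le> r" "p \<noteq> q" for t
        using that I by (auto simp: I_def)
      then show ?thesis by (auto simp: pql intro!: image_eqI[of _ _ r])
    qed
  qed
qed

section \<open>Zeros on the product of hemispheres as frames\<close>

theorem corollary3p5:
  fixes n k :: nat
    and f :: "(nat \<Rightarrow> nat \<Rightarrow> real) \<Rightarrow> (nat \<Rightarrow> nat \<Rightarrow> real)"
  assumes "1 \<le> k" and "k \<le> n"
    and "continuous_map (flag_frames n k) (rep_space k (n - k)) f"
    and "equivariant_on (Z2_power k) (topspace (flag_frames n k))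
           (frame_act k) (rep_act k (n - k)) f"
  shows "\<exists>x \<in> topspace (flag_frames n k). f x = rep_zero k (n - k)"
proof -
  let ?m = "n - k" and ?M = "topspace (flag_frames n k)" and ?Y = "tuple_space k"
  have ext: "\<exists>F. continuous_map ?Y euclideanreal F \<and>
      (\<forall>x. \<forall>p\<in>{1..k}. F (frame_act k (Z2_gen k p) x) = (if p = j then - F x else F x)) \<and>
      (\<forall>x\<in>?M. F x = 0 \<longrightarrow> f x l j = 0)" if l: "l \<in> {1..?m}" and j: "j \<in> {1..k}" for l j
  proof (rule equivariant_extension[OF assms(1,2), of "\<lambda>x. f x l j" j])
    have "continuous_map (flag_frames n k) (product_topology (\<lambda>_. euclideanreal) {1..k}) (\<lambda>x. f x l)"
      using continuous_map_compose[OF assms(3)[unfolded rep_space_def] continuous_map_product_projection[OF l]]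
      by (simp add: o_def)
    from continuous_map_compose[OF this continuous_map_product_projection[OF j]]
    show "continuous_map (flag_frames n k) euclideanreal (\<lambda>x. f x l j)" by (simp add: o_def)
    fix g x assume "g \<in> carrier (Z2_power k)" "x \<in> ?M"
    then have "f (frame_act k g x) = rep_act k ?m g (f x)"
      using assms(4) by (simp add: equivariant_on_def)
    then show "f (frame_act k g x) l j = (-1) powi g j * f x l j"
      using l j by (simp add: rep_act_def line_act_def)
  next
    fix F assume "continuous_map ?Y euclideanreal F"
      "\<And>x p. p \<in> {1..k} \<Longrightarrow> F (frame_act k (Z2_gen k p) x) = (if p = j then - F x else F x)"
      "\<And>x. x \<in> ?M \<Longrightarrow> F x = 0 \<Longrightarrow> f x l j = 0"
    then show ?thesis by blast
  qed (rule j)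
  define good where "good l j F \<longleftrightarrow> continuous_map ?Y euclideanreal F \<and>
      (\<forall>x. \<forall>p\<in>{1..k}. F (frame_act k (Z2_gen k p) x) = (if p = j then - F x else F x)) \<and>
      (\<forall>x\<in>?M. F x = 0 \<longrightarrow> f x l j = 0)" for l j F
  define F where "F l j = (SOME F. good l j F)" for l j
  have good: "good l j (F l j)" if "l \<in> {1..?m}" "j \<in> {1..k}" for l j
  proof -
    have "\<exists>F. good l j F" unfolding good_def by (rule ext[OF that])
    then show ?thesis unfolding F_def by (rule someI_ex)
  qed
  have F: "\<And>l j. l \<in> {1..?m} \<Longrightarrow> j \<in> {1..k} \<Longrightarrow> continuous_map ?Y euclideanreal (F l j)"
    "\<And>l j x p. l \<in> {1..?m} \<Longrightarrow> j \<in> {1..k} \<Longrightarrow> p \<in> {1..k} \<Longrightarrow>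
      F l j (frame_act k (Z2_gen k p) x) = (if p = j then - F l j x else F l j x)"
    "\<And>l j x. l \<in> {1..?m} \<Longrightarrow> j \<in> {1..k} \<Longrightarrow> x \<in> ?M \<Longrightarrow> F l j x = 0 \<Longrightarrow> f x l j = 0"
    using good unfolding good_def by blast+
  obtain xs where "\<forall>p q l. (p, q, l) \<in> set xs \<longleftrightarrow>
      1 \<le> p \<and> q \<le> k \<and> (p < q \<and> l = 0 \<or> p = q \<and> 1 \<le> l \<and> l \<le> ?m)"
    "\<forall>j\<in>{1..k}. card {t. t < length xs \<and> fst (snd (xs ! t)) = j} = ?m + j - 1"
    "\<forall>r<length xs. {fst (xs ! r), fst (snd (xs ! r))} \<inter> (\<lambda>t. fst (snd (xs ! t))) ` {..r} = {fst (snd (xs ! r))}"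
    using test_function_enumeration[of k ?m] by (elim exE conjE) (rule that)
  note xs = this[rule_format]
  \<comment> \<open>The dimension of the \<open>j\<close>-th sphere, and also the number of test
    functions assigned to block \<open>j\<close>.\<close>
  define d where "d j = ?m + j - 1" for j
  define Q where "Q = unit_cube (SIGMA j:{1..k}. {..<d j})"
  define X where "X y = (\<lambda>j\<in>{1..k}. chart (d j) j y)" for y
  define test where "test it x = (case it of (p, q, l) \<Rightarrow>
      if p < q then euclidean_inner n (x p) (x q) else F l p x)" for it and x :: "nat \<Rightarrow> nat \<Rightarrow> real"
  have contX: "continuous_map (top_of_set Q) ?Y X"
    unfolding tuple_space_def
  proof (subst continuous_map_componentwise, intro conjI ballI)
    fix j assume "j \<in> {1..k}"
    then have "continuous_on Q (\<lambda>y. X y j)"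
      by (auto simp: X_def intro!: continuous_on_coordinatewise_then_product continuous_on_chart)
    then show "continuous_map (top_of_set Q) (powertop_real UNIV) (\<lambda>y. X y j)"
      by (simp add: euclidean_product_topology)
  qed (auto simp: X_def)
  \<comment> \<open>The flip of a cube matches the generator on the boundary of that cube, which is
    where the zero theorem for cubes asks for equivariance.\<close>
  have flipX: "X (flip j y) = frame_act k (Z2_gen k j) (X y)"
    if "i < d j" "\<bar>y (j, i)\<bar> = 1" for i j y
  proof
    fix j'
    show "X (flip j y) j' = frame_act k (Z2_gen k j) (X y) j'"
    proof (cases "j' \<in> {1..k}")
      case True
      then show ?thesis using chart_flip[of i "d j" y j] that chart_flip_other[of j' j "d j'" y]
        by (auto simp: frame_act_gen X_def)
    next
      case False
      then show ?thesis by (auto simp: X_def frame_act_def)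
    qed
  qed
  have item: "xs ! r \<in> set xs" if "r < length xs" for r using that by simp
  \<comment> \<open>The character of the test function at \<open>(p, q, l)\<close> is nontrivial
    exactly on the blocks \<open>p\<close> and \<open>q\<close>, which coincide for the components
    of the map.\<close>
  have "\<exists>y\<in>unit_cube (SIGMA j:{1..k}. {..<d j}). \<forall>r<length xs. test (xs ! r) (X y) = 0"
  proof (rule equivariant_cube_zero[where ch = "\<lambda>r. {fst (xs ! r), fst (snd (xs ! r))}"
        and step = "\<lambda>r. fst (snd (xs ! r))"])
    fix r assume r: "r < length xs"
    obtain p q l where pql: "xs ! r = (p, q, l)" by (cases "xs ! r") auto
    have it: "1 \<le> p \<and> q \<le> k \<and> (p < q \<and> l = 0 \<or> p = q \<and> 1 \<le> l \<and> l \<le> ?m)"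
      using item[OF r] xs(1) pql by metis
    have "test (xs ! r) = (if p < q then (\<lambda>x. euclidean_inner n (x p) (x q)) else F l p)"
      by (auto simp: test_def pql)
    then have "continuous_map ?Y euclideanreal (test (xs ! r))"
      using it F(1)[of l p] continuous_map_tuple_inner[of p k q n] by auto
    from continuous_map_compose[OF contX this]
    show "continuous_on (unit_cube (SIGMA j:{1..k}. {..<d j})) (\<lambda>y. test (xs ! r) (X y))"
      by (simp add: o_def Q_def)
    show "fst (snd (xs ! r)) \<in> {1..k}" using it pql by auto
    fix y j assume "y \<in> unit_cube (SIGMA j:{1..k}. {..<d j})" and j: "j \<in> {1..k}"
      and "\<exists>i<d j. \<bar>y (j, i)\<bar> = 1"
    then obtain i where i: "i < d j" "\<bar>y (j, i)\<bar> = 1" by blast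
    show "test (xs ! r) (X (flip j y)) =
        (if j \<in> {fst (xs ! r), fst (snd (xs ! r))} then - test (xs ! r) (X y) else test (xs ! r) (X y))"
    proof (cases "p < q")
      case True
      then have "p \<in> {1..k}" "q \<in> {1..k}" using it by auto
      then show ?thesis using True
        by (auto simp: flipX[of i j y, OF i] test_def pql frame_act_gen euclidean_inner_def sum_negf)
    next
      case False
      then show ?thesis using it F(2)[of l p j "X y"] j by (auto simp: flipX[of i j y, OF i] test_def pql)
    qed
  qed (use xs(2,3) in \<open>auto simp: d_def\<close>)
  then obtain y where zero: "\<And>r. r < length xs \<Longrightarrow> test (xs ! r) (X y) = 0" by blast
  have test0: "test it (X y) = 0" if "it \<in> set xs" for it using zero that by (metis in_set_conv_nth)
  have inner: "euclidean_inner n (X y p) (X y q) = 0" if "p \<in> {1..k}" "q \<in> {1..k}" "p < q" for p q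
    using test0[of "(p, q, 0)"] that xs(1)[of p q 0] by (simp add: test_def)
  have sym: "euclidean_inner n v w = euclidean_inner n w v" for v w
    by (simp add: euclidean_inner_def mult.commute)
  have "X y \<in> ?M"
    unfolding topspace_flag_frames[OF assms(1,2)]
  proof (intro CollectI conjI ballI impI allI)
    fix p q assume "p \<in> {1..k}" "q \<in> {1..k}" "p \<noteq> q"
    then show "euclidean_inner n (X y p) (X y q) = 0"
      using inner[of p q] inner[of q p] sym[of "X y p" "X y q"] by (cases "p < q") auto
  next
    fix j i assume j: "j \<in> {1..k}" "n - k + j \<le> i"
    then have "d j < i" by (auto simp: d_def)
    then show "X y j i = 0" using j by (simp add: X_def chart_zero)
  next
    fix j assume j: "j \<in> {1..k}"
    have "d j < n" using j assms by (auto simp: d_def)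
    have "euclidean_inner n (X y j) (X y j) = (\<Sum>i\<le>d j. chart (d j) j y i * chart (d j) j y i)"
      unfolding euclidean_inner_def
      using j \<open>d j < n\<close> by (intro sum.mono_neutral_cong_right) (auto simp: X_def chart_zero)
    then show "euclidean_inner n (X y j) (X y j) = 1"
      using chart_norm[of "d j" j y] by (simp add: power2_eq_square)
  qed (simp add: X_def)
  moreover have "f (X y) = rep_zero k ?m"
  proof -
    have "f (X y) l j = 0" if lj: "l \<in> {1..?m}" "j \<in> {1..k}" for l j
    proof (rule F(3)[OF lj \<open>X y \<in> ?M\<close>])
      show "F l j (X y) = 0" using test0[of "(j, j, l)"] lj xs(1)[of j j l] by (simp add: test_def)
    qed
    moreover have "f (X y) \<in> topspace (rep_space k ?m)"
      using assms(3) \<open>X y \<in> ?M\<close> by (auto simp: continuous_map_def)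
    ultimately show ?thesis
      by (fastforce simp: rep_zero_def rep_space_def PiE_iff extensional_def fun_eq_iff)
  qed
  ultimately show ?thesis by blast
qed

end
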